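(* Let $k$ be a field, let $\Sigma \subset \Delta \subset 2^{[n]}$ be simplicial complexes with $\dim k[\Delta] = d$, and let $J$ be the image of $I_{\Sigma}$ in $k[\Delta]$. Suppose that every $(d-1)$-face of $\Delta$ contains a vertex of $\Sigma$, that every $(d-2)$-face of each $(d-1)$-face of $\Delta$ is a $(d-2)$-face of $\Sigma$, and that every $(d-2)$-facet of $\Delta$ contains at least one vertex of $\Sigma$. Then $H^{d-1}_J(k[\Delta]) = 0$.
   Context: Let $[n]=\{1,\dots,n\}$. A simplicial complex $\Delta\subset 2^{[n]}$ is a collection of subsets such that $F\in\Delta$ and $G\subset F$ imply $G\in\Delta$; its elements are called faces. An $i$-face is a face with $i+1$ elements, a facet is a face maximal under inclusion, and an $i$-facet is a facet that is an $i$-face. A vertex of $\Sigma$ is an element $v\in[n]$ with $\{v\}\in\Sigma$. Let $S=k[x_1,\dots,x_n]$ be a polynomial ring over a field $k$, and for $F\subset[n]$ let $x^F=\prod_{i\in F}x_i$. The Stanley-Reisner ideal of $\Delta$ is the square-free monomial ideal $I_\Delta$ of $S$ generated by $\{x^F : F\notin\Delta\}$, and the Stanley-Reisner ring is $k[\Delta]=S/I_\Delta$. For simplicial complexes $\Sigma\subset\Delta\subset 2^{[n]}$ one has $I_\Delta\subset I_\Sigma$. $\dim k[\Delta]$ is the Krull dimension (so $\Delta$ has dimension $d-1$ when $\dim k[\Delta]=d$). $H^i_J(k[\Delta])$ denotes the $i$-th local cohomology module of $k[\Delta]$ supported at $J$.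
   Formalization: The formal theorem adds d ≠ 1 and d ≠ 2: for d = 1 the hypotheses force Σ = Δ, J = 0 and H^0_J = k[Δ] ≠ 0; for d = 2 the claim fails whenever Σ ≠ Δ (e.g. Δ = 2^{1,2}, Σ its two points, J = (xy)), leaving only the trivial case J = 0. *)

theory Defs
  imports
    "HOL-Library.Poly_Mapping"
    "HOL-Library.Extended_Real"
    "HOL-Algebra.Algebra"
begin

section \<open>Simplicial complexes\<close>

text \<open>The void complex \<open>{}\<close> is admitted.\<close>

definition simplicial_complex :: "nat \<Rightarrow> nat set set \<Rightarrow> bool" where
  "simplicial_complex n \<Delta> \<longleftrightarrow> \<Delta> \<subseteq> Pow {1..n} \<and> (\<forall>F\<in>\<Delta>. \<forall>G. G \<subseteq> F \<longrightarrow> G \<in> \<Delta>)"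

definition vertices :: "nat set set \<Rightarrow> nat set" where
  "vertices \<Delta> = {v. {v} \<in> \<Delta>}"

definition faces :: "nat set set \<Rightarrow> int \<Rightarrow> nat set set" where
  "faces \<Delta> i = {F \<in> \<Delta>. int (card F) = i + 1}"

definition facets :: "nat set set \<Rightarrow> int \<Rightarrow> nat set set" where
  "facets \<Delta> i = {F \<in> faces \<Delta> i. \<forall>G\<in>\<Delta>. F \<subseteq> G \<longrightarrow> G = F}"


section \<open>Stanley-Reisner rings\<close>

text \<open>A monomial is an exponent vector of type \<^typ>\<open>nat \<Rightarrow>\<^sub>0 nat\<close>; the ring \<open>k[x\<^sub>1, \<dots>, x\<^sub>n]\<close>
  consists of the polynomials all of whose monomials involve only variables with index in
  \<open>{1..n}\<close>.\<close>

type_synonym 'k mpoly = "(nat \<Rightarrow>\<^sub>0 nat) \<Rightarrow>\<^sub>0 'k"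

definition poly_ring :: "nat \<Rightarrow> 'k::field mpoly ring" where
  "poly_ring n =
    \<lparr>carrier = {p. \<forall>m \<in> Poly_Mapping.keys p. Poly_Mapping.keys m \<subseteq> {1..n}},
     monoid.mult = (*), one = 1, ring.zero = 0, add = (+)\<rparr>"

definition mpoly_var :: "nat \<Rightarrow> 'k::field mpoly" where
  "mpoly_var i = Poly_Mapping.single (Poly_Mapping.single i 1) 1"

definition sqfree_monom :: "nat set \<Rightarrow> 'k::field mpoly" where
  "sqfree_monom F = (\<Prod>i\<in>F. mpoly_var i)"

definition SR_ideal :: "nat \<Rightarrow> nat set set \<Rightarrow> 'k::field mpoly set" where
  "SR_ideal n \<Delta> = Idl\<^bsub>poly_ring n\<^esub> (sqfree_monom ` (Pow {1..n} - \<Delta>))"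

definition SR_ring :: "nat \<Rightarrow> nat set set \<Rightarrow> 'k::field mpoly set ring" where
  "SR_ring n \<Delta> = poly_ring n Quot SR_ideal n \<Delta>"

definition SR_ideal_image :: "nat \<Rightarrow> nat set set \<Rightarrow> nat set set \<Rightarrow> 'k::field mpoly set set" where
  "SR_ideal_image n \<Delta> \<Sigma> = (\<lambda>p. SR_ideal n \<Delta> +>\<^bsub>poly_ring n\<^esub> p) ` SR_ideal n \<Sigma>"


section \<open>Krull dimension\<close>

text \<open>The supremum of the lengths of strict chains of prime ideals. It is \<open>-\<infinity>\<close> for the zero ring.\<close>

definition krull_dim :: "('a, 'b) ring_scheme \<Rightarrow> ereal" where
  "krull_dim R = Sup {ereal (real l) | l.
     \<exists>P :: nat \<Rightarrow> 'a set. (\<forall>i\<le>l. primeideal (P i) R) \<and> (\<forall>i<l. P i \<subset> P (Suc i))}"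


section \<open>Local cohomology\<close>

definition mod_hom ::
    "('a, 'b) ring_scheme \<Rightarrow> ('a, 'c, 'd) module_scheme \<Rightarrow> ('a, 'e, 'f) module_scheme \<Rightarrow> ('c \<Rightarrow> 'e) set"
  where
  "mod_hom R M N = {h \<in> carrier M \<rightarrow> carrier N.
     (\<forall>x\<in>carrier M. \<forall>y\<in>carrier M. h (x \<oplus>\<^bsub>M\<^esub> y) = h x \<oplus>\<^bsub>N\<^esub> h y) \<and>
     (\<forall>r\<in>carrier R. \<forall>x\<in>carrier M. h (r \<odot>\<^bsub>M\<^esub> x) = r \<odot>\<^bsub>N\<^esub> h x)}"

definition regular_module :: "('a, 'b) ring_scheme \<Rightarrow> ('a, 'a) module" where
  "regular_module R = \<lparr>carrier = carrier R, monoid.mult = monoid.mult R, one = one R,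
     ring.zero = ring.zero R, add = add R, smult = monoid.mult R\<rparr>"

text \<open>Only the additive structure and the scalar multiplication of a module record matter;
  the fields \<open>mult\<close> and \<open>one\<close> have no meaning here. The elements of \<open>M / N\<close> are the cosets of \<open>N\<close>.\<close>

definition quotient_module ::
    "('a, 'c, 'd) module_scheme \<Rightarrow> 'c set \<Rightarrow> ('a, 'c set) module" where
  "quotient_module M N = \<lparr>carrier = a_rcosets\<^bsub>M\<^esub> N, monoid.mult = undefined, one = undefined,
     ring.zero = N, add = set_add M, smult = (\<lambda>r C. \<Union>x\<in>C. N +>\<^bsub>M\<^esub> (r \<odot>\<^bsub>M\<^esub> x))\<rparr>"

text \<open>Injectivity is the extension property along all injective homomorphisms \<open>A \<rightarrow> B\<close>. As one
  cannot quantify over types, \<open>A\<close> and \<open>B\<close> range over the modules whose carrier is a subset of the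
  type \<^typ>\<open>'a + 'm\<close>. This is no restriction: \<^typ>\<open>'a + 'm\<close> contains a copy of the ring, so by
  Baer's criterion the inclusions of ideals into the ring already suffice.\<close>

definition injective_module :: "('a, 'b) ring_scheme \<Rightarrow> ('a, 'm) module \<Rightarrow> bool" where
  "injective_module R E \<longleftrightarrow> module R E \<and>
    (\<forall>(A :: ('a, 'a + 'm) module) (B :: ('a, 'a + 'm) module). module R A \<longrightarrow> module R B \<longrightarrow>
      (\<forall>f \<in> mod_hom R A B. inj_on f (carrier A) \<longrightarrow>
        (\<forall>g \<in> mod_hom R A E. \<exists>h \<in> mod_hom R B E. \<forall>x\<in>carrier A. h (f x) = g x)))"

text \<open>Complexes are indexed by all integers, so that degree \<open>0\<close> needs no special treatment when
  cohomology is taken; a resolution vanishes in negative degrees. The injective resolution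
  \<open>0 \<rightarrow> M \<rightarrow> I\<^sup>0 \<rightarrow> I\<^sup>1 \<rightarrow> \<dots>\<close> has augmentation \<open>\<epsilon> : M \<rightarrow> I\<^sup>0\<close> and differentials
  \<open>\<delta>\<^sup>i : I\<^sup>i \<rightarrow> I\<^sup>i\<^sup>+\<^sup>1\<close>.\<close>

definition injective_resolution ::
    "('a, 'b) ring_scheme \<Rightarrow> ('a, 'c, 'd) module_scheme \<Rightarrow> ('c \<Rightarrow> 'm) \<Rightarrow>
     (int \<Rightarrow> ('a, 'm) module) \<Rightarrow> (int \<Rightarrow> 'm \<Rightarrow> 'm) \<Rightarrow> bool" where
  "injective_resolution R M \<epsilon> I \<delta> \<longleftrightarrow>
     (\<forall>i. injective_module R (I i)) \<and>
     (\<forall>i<0. carrier (I i) = {\<zero>\<^bsub>I i\<^esub>}) \<and>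
     (\<forall>i. \<delta> i \<in> mod_hom R (I i) (I (i + 1))) \<and>
     \<epsilon> \<in> mod_hom R M (I 0) \<and>
     inj_on \<epsilon> (carrier M) \<and>
     \<epsilon> ` carrier M = a_kernel (I 0) (I 1) (\<delta> 0) \<and>
     (\<forall>i>0. \<delta> (i - 1) ` carrier (I (i - 1)) = a_kernel (I i) (I (i + 1)) (\<delta> i))"

text \<open>\<open>\<Gamma>\<^sub>J(M)\<close>, the submodule of the elements annihilated by some power of the ideal \<open>J\<close>; powers
  are taken in the multiplicative monoid of ideals.\<close>

definition torsion_module ::
    "('a, 'b) ring_scheme \<Rightarrow> 'a set \<Rightarrow> ('a, 'm) module \<Rightarrow> ('a, 'm) module" where
  "torsion_module R J M = M\<lparr>carrier :=
     {x \<in> carrier M. \<exists>t::nat. \<forall>r \<in> J [^]\<^bsub>ideals_set R\<^esub> t. r \<odot>\<^bsub>M\<^esub> x = \<zero>\<^bsub>M\<^esub>}\<rparr>"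

definition cohomology ::
    "(int \<Rightarrow> ('a, 'm) module) \<Rightarrow> (int \<Rightarrow> 'm \<Rightarrow> 'm) \<Rightarrow> int \<Rightarrow> ('a, 'm set) module" where
  "cohomology C \<delta> i = quotient_module
     ((C i)\<lparr>carrier := a_kernel (C i) (C (i + 1)) (\<delta> i)\<rparr>) (\<delta> (i - 1) ` carrier (C (i - 1)))"

text \<open>The local cohomology \<open>H\<^sup>i\<^sub>J(M)\<close> is the \<open>i\<close>-th right derived functor of \<open>\<Gamma>\<^sub>J\<close>: the cohomology
  of \<open>\<Gamma>\<^sub>J(I)\<close> for an injective resolution \<open>I\<close> of \<open>M\<close>. As usual it depends on the chosen
  resolution only up to isomorphism.\<close>

definition local_cohomology ::
    "('a, 'b) ring_scheme \<Rightarrow> 'a set \<Rightarrow> (int \<Rightarrow> ('a, 'm) module) \<Rightarrow> (int \<Rightarrow> 'm \<Rightarrow> 'm) \<Rightarrow> int \<Rightarrow>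
     ('a, 'm set) module" where
  "local_cohomology R J I \<delta> i = cohomology (\<lambda>j. torsion_module R J (I j)) \<delta> i"

end

theory Submission
  imports Defs
begin

text \<open>
  Local cohomology supported at an ideal vanishes in all degrees above the number of elements that
  generate the ideal up to radical. The theorem holds because, for \<open>d \<ge> 3\<close>, the ideal \<open>J\<close> has the
  same radical as an ideal generated by \<open>d - 2\<close> elements; for \<open>d = 0\<close> the degree is negative.

  These elements come from the lemma of Schmitt and Vogel (\<open>schmitt_vogel\<close>). Up to radical, \<open>J\<close> is
  generated by the monomials \<open>x\<^sup>F\<close> for the faces \<open>F\<close> of a suitable set \<open>\<G> \<subseteq> \<Delta> - \<Sigma>\<close>. If the faces in
  \<open>\<G>\<close> are ranked such that, in \<open>k[\<Delta>]\<close>, the product of two monomials of equal rank is zero or a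
  multiple of a monomial of higher rank, then one element for each rank is enough, namely the sum of
  the monomials of this rank. Ranking by the number of vertices is always possible, but non-empty
  faces of \<open>\<Delta> - \<Sigma>\<close> can have any number of vertices between \<open>1\<close> and \<open>d\<close>. The hypotheses save two
  ranks (\<open>exists_ranked_cover\<close>). A face with \<open>d\<close> vertices has its proper faces in \<open>\<Sigma>\<close>, so that its
  monomial annihilates all others and its rank is of no importance. Every face with \<open>d - 1\<close> vertices
  contains a vertex of \<open>\<Sigma>\<close>; since no singleton in \<open>\<Delta> - \<Sigma>\<close> does, lowering the rank of the faces that
  contain a vertex of \<open>\<Sigma>\<close> by one removes the top rank without creating a new bottom rank.
  Collisions between a face and its extension by a vertex of \<open>\<Sigma>\<close> are avoided by omitting the
  latter, whose monomial is redundant.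

  The vanishing is proved directly on a given injective resolution
  (\<open>power_torsion_cocycle_is_coboundary\<close>), by induction on the number of elements. One more element
  \<open>f\<close> shifts the degree by one, because for an injective module \<open>E\<close> the torsion \<open>\<Gamma>(E)\<close> maps onto its
  localization at \<open>f\<close> (\<open>torsion_divisible\<close>). This surjectivity rests on the ascending chain
  condition in \<open>k[\<Delta>]\<close>, hence on Hilbert's basis theorem.

  The number \<open>d\<close> is given as a Krull dimension. That it bounds the number of vertices of every face
  follows from an explicit chain of primes (\<open>card_face_le_krull_dim\<close>).
\<close>

section \<open>The ascending chain condition and Hilbert's basis theorem\<close>

text \<open>For a subset of a commutative ring, being a subring or an ideal is a closure condition, which
  avoids a ring record for every intermediate polynomial ring.\<close>

definition ideal_of :: "'r::comm_ring_1 set \<Rightarrow> 'r set \<Rightarrow> bool" where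
  "ideal_of A K \<longleftrightarrow> K \<subseteq> A \<and> 0 \<in> K \<and> (\<forall>x\<in>K. \<forall>y\<in>K. x + y \<in> K) \<and> (\<forall>a\<in>A. \<forall>x\<in>K. a * x \<in> K)"

definition subring_of :: "'r::comm_ring_1 set \<Rightarrow> bool" where
  "subring_of A \<longleftrightarrow> 0 \<in> A \<and> 1 \<in> A \<and> (\<forall>x\<in>A. - x \<in> A) \<and> (\<forall>x\<in>A. \<forall>y\<in>A. x + y \<in> A \<and> x * y \<in> A)"

lemma ideal_ofD:
  assumes "ideal_of A K"
  shows "K \<subseteq> A" "0 \<in> K" "x \<in> K \<Longrightarrow> y \<in> K \<Longrightarrow> x + y \<in> K" "a \<in> A \<Longrightarrow> x \<in> K \<Longrightarrow> a * x \<in> K"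
  using assms by (simp_all add: ideal_of_def)

lemma subring_ofD:
  assumes "subring_of A"
  shows "0 \<in> A" "1 \<in> A" "x \<in> A \<Longrightarrow> - x \<in> A" "x \<in> A \<Longrightarrow> y \<in> A \<Longrightarrow> x + y \<in> A"
    "x \<in> A \<Longrightarrow> y \<in> A \<Longrightarrow> x * y \<in> A"
  using assms by (simp_all add: subring_of_def)

text \<open>The ascending chain condition for the sets with property \<open>P\<close>. Asking only for an upper bound
  \<open>K N\<close> of the chain, instead of eventual equality, is equivalent for monotone chains.\<close>

definition acc_on :: "('i set \<Rightarrow> bool) \<Rightarrow> bool" where
  "acc_on P \<longleftrightarrow> (\<forall>K :: nat \<Rightarrow> 'i set. (\<forall>j. P (K j)) \<longrightarrow> mono K \<longrightarrow> (\<exists>N. \<forall>j. K j \<subseteq> K N))"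

lemma acc_onD:
  assumes "acc_on P" "\<And>j. P (K j)" "mono (K :: nat \<Rightarrow> 'i set)"
  shows "\<exists>N. \<forall>j. K j \<subseteq> K N"
  using assms unfolding acc_on_def by blast

text \<open>The diagonal of the double chain has an upper bound \<open>L D D\<close>, which dominates all rows with
  index at least \<open>D\<close>. The finitely many remaining rows are bounded one by one.\<close>

lemma acc_on_double_chain:
  fixes L :: "nat \<Rightarrow> nat \<Rightarrow> 'i set"
  assumes acc: "acc_on P" and P: "\<And>m j. P (L m j)"
    and mono: "\<And>m m' j j'. m \<le> m' \<Longrightarrow> j \<le> j' \<Longrightarrow> L m j \<subseteq> L m' j'"
  shows "\<exists>N. \<forall>m j. L m j \<subseteq> L m N"
proof -
  have "mono (\<lambda>j. L j j)" by (intro monoI mono)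
  from acc_onD[OF acc P this] obtain D where D: "\<And>j. L j j \<subseteq> L D D" by blast
  have "\<exists>N. \<forall>j. L m j \<subseteq> L m N" for m
  proof -
    have "mono (L m)" by (intro monoI mono order_refl)
    from acc_onD[OF acc P this] show ?thesis .
  qed
  then obtain s where s: "\<And>m j. L m j \<subseteq> L m (s m)" by metis
  define N where "N = Max (insert D (s ` {..<D}))"
  have Ns: "s m \<le> N" if "m < D" for m unfolding N_def using that by auto
  have ND: "D \<le> N" unfolding N_def by simp
  have "L m j \<subseteq> L m N" for m j
  proof (cases "m < D")
    case True
    show ?thesis using s[of m j] mono[OF order_refl[of m] Ns[OF True]] by (rule subset_trans)
  next
    case False
    have "L m j \<subseteq> L (max m j) (max m j)" by (rule mono) auto
    also have "\<dots> \<subseteq> L D D" by (rule D)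
    also have "\<dots> \<subseteq> L m N" using False ND by (intro mono) auto
    finally show ?thesis .
  qed
  then show ?thesis by blast
qed

text \<open>The possible coefficients of \<open>x\<^sup>m\<close> in expressions of degree at most \<open>m\<close> for the elements of
  \<open>K\<close>. An element can have several such expressions, as \<open>x\<close> may be algebraic over \<open>A\<close>.\<close>

definition leading_coeffs :: "'r::comm_ring_1 set \<Rightarrow> 'r \<Rightarrow> 'r set \<Rightarrow> nat \<Rightarrow> 'r set" where
  "leading_coeffs A x K m =
     {a \<in> A. \<exists>c. (\<forall>i. c i \<in> A) \<and> (\<Sum>i<m. c i * x ^ i) + a * x ^ m \<in> K}"

lemma leading_coeffsI:
  assumes "a \<in> A" "\<And>i. c i \<in> A" "(\<Sum>i<m. c i * x ^ i) + a * x ^ m \<in> K"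
  shows "a \<in> leading_coeffs A x K m"
  using assms unfolding leading_coeffs_def by blast

lemma ideal_leading_coeffs:
  assumes A: "subring_of A" and K: "ideal_of B K" and AB: "A \<subseteq> B"
  shows "ideal_of A (leading_coeffs A x K m)"
  unfolding ideal_of_def
proof (intro conjI ballI)
  show "leading_coeffs A x K m \<subseteq> A" unfolding leading_coeffs_def by auto
  show "0 \<in> leading_coeffs A x K m"
    using subring_ofD(1)[OF A] ideal_ofD(2)[OF K] by (intro leading_coeffsI[of _ _ "\<lambda>_. 0"]) simp_all
next
  fix a b assume "a \<in> leading_coeffs A x K m" "b \<in> leading_coeffs A x K m"
  then obtain c e where c: "a \<in> A" "\<And>i. c i \<in> A" "(\<Sum>i<m. c i * x ^ i) + a * x ^ m \<in> K"
    and e: "b \<in> A" "\<And>i. e i \<in> A" "(\<Sum>i<m. e i * x ^ i) + b * x ^ m \<in> K"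
    unfolding leading_coeffs_def by blast
  have "(\<Sum>i<m. (c i + e i) * x ^ i) + (a + b) * x ^ m =
      ((\<Sum>i<m. c i * x ^ i) + a * x ^ m) + ((\<Sum>i<m. e i * x ^ i) + b * x ^ m)"
    by (simp add: algebra_simps sum.distrib)
  then have "(\<Sum>i<m. (c i + e i) * x ^ i) + (a + b) * x ^ m \<in> K"
    using ideal_ofD(3)[OF K c(3) e(3)] by simp
  then show "a + b \<in> leading_coeffs A x K m"
    by (intro leading_coeffsI[of _ _ "\<lambda>i. c i + e i"] subring_ofD[OF A] c e)
next
  fix r a assume r: "r \<in> A" and "a \<in> leading_coeffs A x K m"
  then obtain c where c: "a \<in> A" "\<And>i. c i \<in> A" "(\<Sum>i<m. c i * x ^ i) + a * x ^ m \<in> K"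
    unfolding leading_coeffs_def by blast
  have "(\<Sum>i<m. (r * c i) * x ^ i) + (r * a) * x ^ m = r * ((\<Sum>i<m. c i * x ^ i) + a * x ^ m)"
    by (simp add: algebra_simps sum_distrib_left)
  then have "(\<Sum>i<m. (r * c i) * x ^ i) + (r * a) * x ^ m \<in> K"
    using ideal_ofD(4)[OF K _ c(3), of r] r AB by auto
  then show "r * a \<in> leading_coeffs A x K m"
    by (intro leading_coeffsI[of _ _ "\<lambda>i. r * c i"] subring_ofD[OF A] c r)
qed

lemma leading_coeffs_Suc_subset:
  assumes A: "subring_of A" and K: "ideal_of B K" and x: "x \<in> B"
  shows "leading_coeffs A x K m \<subseteq> leading_coeffs A x K (Suc m)"
proof
  fix a assume "a \<in> leading_coeffs A x K m"
  then obtain c where c: "a \<in> A" "\<And>i. c i \<in> A" "(\<Sum>i<m. c i * x ^ i) + a * x ^ m \<in> K"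
    unfolding leading_coeffs_def by blast
  define e where "e = (\<lambda>i. case i of 0 \<Rightarrow> 0 | Suc i \<Rightarrow> c i)"
  have "(\<Sum>i<Suc m. e i * x ^ i) + a * x ^ Suc m = x * ((\<Sum>i<m. c i * x ^ i) + a * x ^ m)"
    unfolding e_def by (subst sum.lessThan_Suc_shift) (simp add: algebra_simps sum_distrib_left)
  then have "(\<Sum>i<Suc m. e i * x ^ i) + a * x ^ Suc m \<in> K"
    using ideal_ofD(4)[OF K x c(3)] by simp
  moreover have "e i \<in> A" for i
    using c(2) subring_ofD(1)[OF A] unfolding e_def by (auto split: nat.split)
  ultimately show "a \<in> leading_coeffs A x K (Suc m)" using c(1) by (intro leading_coeffsI)
qed

text \<open>Subtracting an element of the smaller ideal with the same leading coefficient lowers the degree,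
  so that induction on the degree applies.\<close>

lemma ideal_subset_if_leading_coeffs_subset:
  assumes A: "subring_of A" and B: "subring_of B"
    and K: "ideal_of B K" and L: "ideal_of B L" and KL: "K \<subseteq> L"
    and lc: "\<And>m. leading_coeffs A x L m \<subseteq> leading_coeffs A x K m"
    and gen: "\<And>b. b \<in> B \<Longrightarrow> \<exists>m c. (\<forall>i. c i \<in> A) \<and> b = (\<Sum>i<m::nat. c i * x ^ i)"
  shows "L \<subseteq> K"
proof -
  have "(\<Sum>i<m. c i * x ^ i) \<in> K" if "(\<Sum>i<m. c i * x ^ i) \<in> L" "\<And>i. c i \<in> A" for c m
    using that
  proof (induction m arbitrary: c)
    case 0
    then show ?case using ideal_ofD(2)[OF K] by simp
  next
    case (Suc m)
    then have "c m \<in> leading_coeffs A x L m" by (intro leading_coeffsI) auto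
    then have "c m \<in> leading_coeffs A x K m" using lc by blast
    then obtain e where e: "\<And>i. e i \<in> A" "(\<Sum>i<m. e i * x ^ i) + c m * x ^ m \<in> K" (is "?k \<in> K")
      unfolding leading_coeffs_def by blast
    have "-1 * ?k \<in> K"
      using ideal_ofD(4)[OF K subring_ofD(3)[OF B subring_ofD(2)[OF B]] e(2)] .
    then have "(\<Sum>i<Suc m. c i * x ^ i) + -1 * ?k \<in> L"
      using KL by (intro ideal_ofD(3)[OF L Suc.prems(1)]) auto
    moreover have eq: "(\<Sum>i<Suc m. c i * x ^ i) + -1 * ?k = (\<Sum>i<m. (c i + - e i) * x ^ i)"
      by (simp add: left_diff_distrib sum_subtractf)
    moreover have "c i + - e i \<in> A" for i
      by (intro subring_ofD(3,4)[OF A] Suc.prems(2) e(1))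
    ultimately have "(\<Sum>i<Suc m. c i * x ^ i) + -1 * ?k \<in> K" using Suc.IH[of "\<lambda>i. c i + - e i"] by simp
    from ideal_ofD(3)[OF K this e(2)] show ?case by simp
  qed
  then show ?thesis using gen ideal_ofD(1)[OF L] by blast
qed

text \<open>Hilbert's basis theorem for \<open>B = A[x]\<close>: an ascending chain of ideals of \<open>B\<close> yields the double
  chain of its ideals of leading coefficients in \<open>A\<close>, indexed by the degree and the position in the
  chain, and an upper bound for the latter chain gives one for the former.\<close>

lemma hilbert_basis:
  fixes A B :: "'r::comm_ring_1 set"
  assumes A: "subring_of A" and acc: "acc_on (ideal_of A)"
    and B: "subring_of B" and AB: "A \<subseteq> B" and x: "x \<in> B"
    and gen: "\<And>b. b \<in> B \<Longrightarrow> \<exists>m c. (\<forall>i. c i \<in> A) \<and> b = (\<Sum>i<m::nat. c i * x ^ i)"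
  shows "acc_on (ideal_of B)"
  unfolding acc_on_def
proof (intro allI impI)
  fix K :: "nat \<Rightarrow> 'r set" assume K: "\<forall>j. ideal_of B (K j)" and mK: "mono K"
  have mono_L: "leading_coeffs A x (K j) m \<subseteq> leading_coeffs A x (K j') m'"
    if "m \<le> m'" "j \<le> j'" for m m' j j'
  proof -
    have "leading_coeffs A x (K j) m \<subseteq> leading_coeffs A x (K j) m'"
      using lift_Suc_mono_le[of "leading_coeffs A x (K j)"]
        leading_coeffs_Suc_subset[OF A spec[OF K] x] that by blast
    moreover have "K j \<subseteq> K j'" using mK that by (auto simp: mono_def)
    ultimately show ?thesis unfolding leading_coeffs_def by blast
  qed
  obtain N where N: "\<And>m j. leading_coeffs A x (K j) m \<subseteq> leading_coeffs A x (K N) m"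
    using acc_on_double_chain[OF acc, of "\<lambda>m j. leading_coeffs A x (K j) m"]
      ideal_leading_coeffs[OF A spec[OF K] AB] mono_L by metis
  have "K j \<subseteq> K N" for j
  proof -
    \<comment> \<open>the later of the two ideals contains both\<close>
    have "K N \<subseteq> K (max j N)" "K j \<subseteq> K (max j N)" using mK by (auto simp: mono_def)
    then show ?thesis
      using ideal_subset_if_leading_coeffs_subset[OF A B spec[OF K, of N] spec[OF K, of "max j N"] _ N gen]
      by simp
  qed
  then show "\<exists>N. \<forall>j. K j \<subseteq> K N" by blast
qed

definition polys_in :: "nat set \<Rightarrow> 'k::field mpoly set" where
  "polys_in V = {p. \<forall>m \<in> Poly_Mapping.keys p. Poly_Mapping.keys m \<subseteq> V}"

lemma carrier_poly_ring: "carrier (poly_ring n) = polys_in {1..n}"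
  by (simp add: poly_ring_def polys_in_def)

lemma poly_ring_simps [simp]:
  "monoid.mult (poly_ring n) = (*)" "one (poly_ring n) = 1" "ring.zero (poly_ring n) = 0"
  "add (poly_ring n) = (+)"
  by (simp_all add: poly_ring_def)

lemma keys_monom_add: "Poly_Mapping.keys (a + b :: nat \<Rightarrow>\<^sub>0 nat) = Poly_Mapping.keys a \<union> Poly_Mapping.keys b"
  by (auto simp: in_keys_iff lookup_add)

lemma polys_in_add: "p \<in> polys_in V \<Longrightarrow> q \<in> polys_in V \<Longrightarrow> p + q \<in> polys_in V"
  using keys_add[of p q] unfolding polys_in_def by blast

lemma polys_in_mult:
  assumes "p \<in> polys_in V" "q \<in> polys_in V"
  shows "p * q \<in> polys_in V"
  unfolding polys_in_def
proof (intro CollectI ballI)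
  fix m assume "m \<in> Poly_Mapping.keys (p * q)"
  then obtain a b where "m = a + b" "a \<in> Poly_Mapping.keys p" "b \<in> Poly_Mapping.keys q"
    using keys_mult[of p q] by blast
  then show "Poly_Mapping.keys m \<subseteq> V"
    using assms unfolding polys_in_def by (simp add: keys_monom_add)
qed

lemma polys_in_0: "0 \<in> polys_in V" and polys_in_1: "1 \<in> polys_in V"
  and polys_in_uminus: "p \<in> polys_in V \<Longrightarrow> - p \<in> polys_in V"
  by (auto simp: polys_in_def)

lemmas polys_in_closed = polys_in_0 polys_in_1 polys_in_uminus polys_in_add polys_in_mult

lemma subring_polys_in: "subring_of (polys_in V)"
  by (simp add: subring_of_def polys_in_closed)

lemma poly_mapping_sum_single:
  "p = (\<Sum>m\<in>Poly_Mapping.keys p. Poly_Mapping.single m (Poly_Mapping.lookup p m))"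
  by (rule poly_mapping_eqI) (auto simp: lookup_sum lookup_single when_def in_keys_iff)

lemma mpoly_var_power: "mpoly_var i ^ e = Poly_Mapping.single (Poly_Mapping.single i e) 1"
  by (induction e) (auto simp: mpoly_var_def mult_single simp flip: single_add)

lemma polys_in_insert_decomp:
  assumes "b \<in> polys_in (insert v V)"
  shows "\<exists>m c. (\<forall>i. c i \<in> polys_in V) \<and> b = (\<Sum>i<m::nat. c i * mpoly_var v ^ i)"
proof -
  let ?good = "\<lambda>b. \<exists>m c. (\<forall>i. c i \<in> polys_in V) \<and> b = (\<Sum>i<m::nat. c i * mpoly_var v ^ i)"
  have single: "?good (Poly_Mapping.single a s)"
    if a: "Poly_Mapping.keys a \<subseteq> insert v V" for a :: "nat \<Rightarrow>\<^sub>0 nat" and s :: 'a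
  proof -
    let ?e = "Poly_Mapping.lookup a v"
    let ?c = "\<lambda>i. if i = ?e then Poly_Mapping.single (a - Poly_Mapping.single v ?e) s else 0"
    have "Poly_Mapping.keys (a - Poly_Mapping.single v ?e) \<subseteq> V"
      using a by (auto simp: in_keys_iff lookup_minus lookup_single when_def subset_iff split: if_splits)
    then have "\<forall>i. ?c i \<in> polys_in V" by (auto simp: polys_in_def split: if_splits)
    moreover have "a - Poly_Mapping.single v ?e + Poly_Mapping.single v ?e = a"
      by (rule poly_mapping_eqI) (auto simp: lookup_minus lookup_add lookup_single when_def)
    then have "Poly_Mapping.single a s = ?c ?e * mpoly_var v ^ ?e"
      by (simp add: mpoly_var_power mult_single)
    then have "Poly_Mapping.single a s = (\<Sum>i<Suc ?e. ?c i * mpoly_var v ^ i)"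
      by simp
    ultimately show ?thesis by (intro exI[of _ "Suc ?e"] exI[of _ ?c] conjI)
  qed
  have add: "?good (p + q)" if pq: "?good p" "?good q" for p q :: "'a mpoly"
  proof -
    from pq(1) obtain m c where
      mc: "\<forall>i. c i \<in> polys_in V" "p = (\<Sum>i<m::nat. c i * mpoly_var v ^ i)" by blast
    from pq(2) obtain m' c' where
      mc': "\<forall>i. c' i \<in> polys_in V" "q = (\<Sum>i<m'::nat. c' i * mpoly_var v ^ i)" by blast
    let ?c = "\<lambda>i. (if i < m then c i else 0) + (if i < m' then c' i else 0)"
    have pad: "(\<Sum>i<m. c i * mpoly_var v ^ i) = (\<Sum>i<M. (if i < m then c i else 0) * mpoly_var v ^ i)"
      if "m \<le> M" for m M and c :: "nat \<Rightarrow> 'a mpoly"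
      using that by (intro sum.mono_neutral_cong_left) simp_all
    have "p = (\<Sum>i<max m m'. (if i < m then c i else 0) * mpoly_var v ^ i)"
      unfolding mc(2) by (rule pad) simp
    moreover have "q = (\<Sum>i<max m m'. (if i < m' then c' i else 0) * mpoly_var v ^ i)"
      unfolding mc'(2) by (rule pad) simp
    ultimately have "p + q = (\<Sum>i<max m m'. ?c i * mpoly_var v ^ i)"
      by (simp only: distrib_right sum.distrib)
    moreover have "\<forall>i. ?c i \<in> polys_in V"
      using mc(1) mc'(1) by (simp add: polys_in_add polys_in_0)
    ultimately show ?thesis by (intro exI[of _ "max m m'"] exI[of _ ?c] conjI)
  qed
  have zero: "?good 0" by (rule exI[of _ 0], rule exI[of _ "\<lambda>_. 0"]) (auto simp: polys_in_def)
  have "?good (\<Sum>m\<in>S. Poly_Mapping.single m (Poly_Mapping.lookup b m))"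
    if "finite S" "S \<subseteq> Poly_Mapping.keys b" for S
    using that
  proof (induction S)
    case (insert a S)
    then have "Poly_Mapping.keys a \<subseteq> insert v V" using assms unfolding polys_in_def by auto
    from add[OF single[OF this]] insert show ?case by simp
  qed (use zero in simp)
  from this[of "Poly_Mapping.keys b"] show ?thesis
    unfolding poly_mapping_sum_single[of b, symmetric] by simp
qed

text \<open>The variables are adjoined one at a time, starting from the field of constants.\<close>

lemma acc_polys_in:
  assumes "finite V"
  shows "acc_on (ideal_of (polys_in V :: 'k::field mpoly set))"
  using assms
proof (induction V)
  case empty
  show ?case
    unfolding acc_on_def
  proof (intro allI impI)
    fix K :: "nat \<Rightarrow> 'k mpoly set"
    assume K: "\<forall>j. ideal_of (polys_in {}) (K j)" and mK: "mono K"
    have full: "K j = polys_in {}" if p: "p \<in> K j" "p \<noteq> 0" for j p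
    proof -
      have Kj: "ideal_of (polys_in {}) (K j)" using K by blast
      have "p \<in> polys_in {}" using Kj p unfolding ideal_of_def by auto
      then have "Poly_Mapping.keys p \<subseteq> {0}" by (auto simp: polys_in_def)
      then have p_single: "p = Poly_Mapping.single 0 (Poly_Mapping.lookup p 0)"
        by (intro poly_mapping_eqI) (auto simp: lookup_single when_def in_keys_iff)
      then have "Poly_Mapping.lookup p 0 \<noteq> 0" using p(2) by (metis single_zero)
      then have "Poly_Mapping.single 0 (inverse (Poly_Mapping.lookup p 0)) * p = 1"
        by (subst p_single) (simp add: mult_single)
      moreover have "Poly_Mapping.single 0 (inverse (Poly_Mapping.lookup p 0)) \<in> polys_in {}"
        by (auto simp: polys_in_def)
      ultimately have "1 \<in> K j" using Kj p(1) unfolding ideal_of_def by metis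
      then have "b * 1 \<in> K j" if "b \<in> polys_in {}" for b
        using that Kj unfolding ideal_of_def by blast
      then show ?thesis using Kj unfolding ideal_of_def by auto
    qed
    show "\<exists>N. \<forall>j. K j \<subseteq> K N"
    proof (cases "\<exists>N. \<exists>p\<in>K N. p \<noteq> 0")
      case True
      then obtain N p where "p \<in> K N" "p \<noteq> 0" by blast
      then have "K N = polys_in {}" by (rule full)
      then have "K j \<subseteq> K N" for j using ideal_ofD(1)[OF spec[OF K]] by simp
      then show ?thesis by blast
    next
      case False
      then have "K j \<subseteq> {0}" for j by blast
      moreover have "0 \<in> K 0" using ideal_ofD(2)[OF spec[OF K]] .
      ultimately show ?thesis by blast
    qed
  qed
next
  case (insert v V)
  have "mpoly_var v \<in> polys_in (insert v V)" "polys_in V \<subseteq> polys_in (insert v V)"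
    by (auto simp: mpoly_var_def polys_in_def)
  then show ?case
    by (intro hilbert_basis[OF subring_polys_in insert.IH subring_polys_in _ _ polys_in_insert_decomp])
qed

lemma cring_poly_ring: "cring (poly_ring n :: 'k::field mpoly ring)"
proof (intro cringI abelian_groupI comm_monoidI)
  fix p :: "'k mpoly" assume "p \<in> carrier (poly_ring n)"
  then show "\<exists>q\<in>carrier (poly_ring n). q \<oplus>\<^bsub>poly_ring n\<^esub> p = \<zero>\<^bsub>poly_ring n\<^esub>"
    by (intro bexI[of _ "- p"]) (simp_all add: carrier_poly_ring polys_in_uminus)
qed (simp_all add: carrier_poly_ring polys_in_closed add_ac mult_ac distrib_right distrib_left)

lemma ideal_poly_ring_imp_ideal_of:
  assumes "ideal K (poly_ring n)"
  shows "ideal_of (carrier (poly_ring n)) K"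
proof -
  interpret ideal K "poly_ring n" by fact
  show ?thesis
    using a_subset additive_subgroup.zero_closed[OF additive_subgroup_axioms]
      additive_subgroup.a_closed[OF additive_subgroup_axioms] I_l_closed
    by (simp add: ideal_of_def)
qed

lemma acc_poly_ring: "acc_on (\<lambda>K. ideal K (poly_ring n :: 'k::field mpoly ring))"
  unfolding acc_on_def
proof (intro allI impI)
  fix K :: "nat \<Rightarrow> 'k mpoly set" assume K: "\<forall>j. ideal (K j) (poly_ring n)" and mono: "mono K"
  have "ideal_of (polys_in {1..n}) (K j)" for j
    using ideal_poly_ring_imp_ideal_of[OF spec[OF K]] by (simp only: carrier_poly_ring)
  from acc_onD[OF acc_polys_in[OF finite_atLeastAtMost] this mono]
  show "\<exists>N. \<forall>j. K j \<subseteq> K N" .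
qed

lemma acc_quotient:
  assumes "cring P" "ideal Q P" and acc: "acc_on (\<lambda>K. ideal K P)"
  shows "acc_on (\<lambda>K. ideal K (P Quot Q))"
  unfolding acc_on_def
proof (intro allI impI)
  interpret P: cring P by fact
  fix K :: "nat \<Rightarrow> _" assume K: "\<forall>j. ideal (K j) (P Quot Q)" and mK: "mono K"
  let ?U = "\<lambda>j. \<Union> (K j)"
  have "mono ?U" using mK by (intro monoI Union_mono) (simp add: monoD)
  from acc_onD[OF acc P.quot_ideal_imp_ring_ideal[OF assms(2) spec[OF K]] this]
  obtain N where N: "\<forall>j. ?U j \<subseteq> ?U N" ..
  have U: "K j = (+>\<^bsub>P\<^esub>) Q ` ?U j" for j
  proof -
    have "K j \<in> (\<lambda>J. (+>\<^bsub>P\<^esub>) Q ` J) ` {J. ideal J P \<and> Q \<subseteq> J}"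
      using bij_betw_imp_surj_on[OF P.quot_ideal_correspondence[OF assms(2)]] K by simp
    then obtain L where L: "ideal L P" "Q \<subseteq> L" "K j = (+>\<^bsub>P\<^esub>) Q ` L" by blast
    have "?U j = L"
      using L P.ideal_incl_iff[OF assms(2) L(1)] by simp
    then show ?thesis using L by simp
  qed
  have "K j \<subseteq> K N" for j
    by (subst (1 2) U) (intro image_mono spec[OF N])
  then show "\<exists>N. \<forall>j. K j \<subseteq> K N" by blast
qed

section \<open>Torsion in injective modules\<close>

text \<open>The extension property of an injective module quantifies over modules whose elements have the
  type of a disjoint sum; ideals are transported there by the left injection.\<close>

definition ideal_copy :: "('a, 'b) ring_scheme \<Rightarrow> 'a set \<Rightarrow> ('a, 'a + 'm) module" where
  "ideal_copy R C = \<lparr>carrier = Inl ` C, monoid.mult = undefined, one = undefined,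
     ring.zero = Inl \<zero>\<^bsub>R\<^esub>, add = (\<lambda>x y. Inl (projl x \<oplus>\<^bsub>R\<^esub> projl y)),
     smult = (\<lambda>r x. Inl (r \<otimes>\<^bsub>R\<^esub> projl x))\<rparr>"

lemma module_ideal_copy:
  assumes "cring R" "ideal C R"
  shows "module R (ideal_copy R C)"
proof -
  interpret R: cring R by fact
  interpret C: ideal C R by fact
  note C_closed = C.zero_closed C.a_closed C.I_l_closed C.Icarr
  show ?thesis
  proof (intro moduleI abelian_groupI)
    fix x assume "x \<in> carrier (ideal_copy R C)"
    then obtain c where "c \<in> C" "x = Inl c" by (auto simp: ideal_copy_def)
    then show "\<exists>y\<in>carrier (ideal_copy R C).
        y \<oplus>\<^bsub>ideal_copy R C\<^esub> x = \<zero>\<^bsub>ideal_copy R C\<^esub>"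
      by (intro bexI[of _ "Inl (\<ominus>\<^bsub>R\<^esub> c)"]) (auto simp: ideal_copy_def R.l_neg C_closed)
  qed (auto simp: ideal_copy_def C_closed R.a_ac R.m_assoc R.l_distr R.r_distr assms(1))
qed

text \<open>The element \<open>e\<close> is the image of \<open>1\<close> under an extension of \<open>g\<close> from the ideal to the ring.\<close>

lemma injective_module_extends:
  fixes R :: "('a, 'b) ring_scheme" and E :: "('a, 'm) module"
  assumes E: "injective_module R E" and C: "ideal C R"
    and g_closed: "\<And>c. c \<in> C \<Longrightarrow> g c \<in> carrier E"
    and g_add: "\<And>c d. c \<in> C \<Longrightarrow> d \<in> C \<Longrightarrow> g (c \<oplus>\<^bsub>R\<^esub> d) = g c \<oplus>\<^bsub>E\<^esub> g d"
    and g_smult: "\<And>r c. r \<in> carrier R \<Longrightarrow> c \<in> C \<Longrightarrow> g (r \<otimes>\<^bsub>R\<^esub> c) = r \<odot>\<^bsub>E\<^esub> g c"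
  shows "\<exists>e\<in>carrier E. \<forall>c\<in>C. c \<odot>\<^bsub>E\<^esub> e = g c"
proof -
  interpret E: module R E using E by (simp add: injective_module_def)
  interpret C: ideal C R by fact
  let ?A = "ideal_copy R C :: ('a, 'a + 'm) module"
  let ?B = "ideal_copy R (carrier R) :: ('a, 'a + 'm) module"
  have cring: "cring R" by (rule E.R.is_cring)
  have "module R ?A" "module R ?B"
    using module_ideal_copy[OF cring C] module_ideal_copy[OF cring E.R.oneideal] .
  moreover have "id \<in> mod_hom R ?A ?B"
    using C.Icarr by (auto simp: mod_hom_def ideal_copy_def)
  moreover have "(\<lambda>x. g (projl x)) \<in> mod_hom R ?A E"
    by (auto simp: mod_hom_def ideal_copy_def g_closed g_add g_smult)
  ultimately obtain h where h: "h \<in> mod_hom R ?B E"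
    and hg: "\<And>x. x \<in> carrier ?A \<Longrightarrow> h (id x) = g (projl x)"
    using E unfolding injective_module_def by (metis inj_on_id)
  show ?thesis
  proof (intro bexI[of _ "h (Inl \<one>\<^bsub>R\<^esub>)"] ballI)
    show "h (Inl \<one>\<^bsub>R\<^esub>) \<in> carrier E"
      using h by (auto simp: mod_hom_def ideal_copy_def)
    fix c assume c: "c \<in> C"
    then have cR: "c \<in> carrier R" by (rule C.Icarr)
    have "h (c \<odot>\<^bsub>?B\<^esub> Inl \<one>\<^bsub>R\<^esub>) = c \<odot>\<^bsub>E\<^esub> h (Inl \<one>\<^bsub>R\<^esub>)"
      using h cR E.R.one_closed unfolding mod_hom_def by (simp add: ideal_copy_def del: E.R.r_one)
    moreover have "c \<odot>\<^bsub>?B\<^esub> Inl \<one>\<^bsub>R\<^esub> = Inl c"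
      using cR by (simp add: ideal_copy_def)
    moreover have "h (Inl c) = g c"
      using hg[of "Inl c"] c by (simp add: ideal_copy_def)
    ultimately show "c \<odot>\<^bsub>E\<^esub> h (Inl \<one>\<^bsub>R\<^esub>) = g c" by simp
  qed
qed

definition annihilator :: "('a, 'b) ring_scheme \<Rightarrow> ('a, 'm) module \<Rightarrow> 'm \<Rightarrow> 'a set" where
  "annihilator R M x = {r \<in> carrier R. r \<odot>\<^bsub>M\<^esub> x = \<zero>\<^bsub>M\<^esub>}"

lemma ideal_annihilator:
  assumes "module R M" "x \<in> carrier M"
  shows "ideal (annihilator R M x) R"
proof -
  interpret M: module R M by fact
  note x = assms(2)
  show ?thesis
  proof (intro idealI M.R.ring_axioms M.R.add.subgroupI)
    show "annihilator R M x \<noteq> {}" using x by (auto simp: annihilator_def)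
  next
    fix a b assume ab: "a \<in> annihilator R M x" "b \<in> annihilator R M x"
    then show "a \<oplus>\<^bsub>R\<^esub> b \<in> annihilator R M x"
      using x by (auto simp: annihilator_def M.smult_l_distr)
    from ab show "\<ominus>\<^bsub>R\<^esub> a \<in> annihilator R M x"
      using x by (auto simp: annihilator_def M.smult_l_minus)
  next
    fix a r assume ar: "a \<in> annihilator R M x" "r \<in> carrier R"
    then show "r \<otimes>\<^bsub>R\<^esub> a \<in> annihilator R M x"
      using x by (auto simp: annihilator_def M.smult_assoc1)
    then show "a \<otimes>\<^bsub>R\<^esub> r \<in> annihilator R M x"
      using ar by (simp add: annihilator_def M.R.m_comm)
  qed (auto simp: annihilator_def)
qed

text \<open>Let \<open>E'\<close> be the submodule of the elements of \<open>E\<close> that \<open>B\<close> annihilates. If \<open>E\<close> is injective over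
  a noetherian ring then \<open>E'\<close> maps onto its localization at \<open>f\<close>: the fraction \<open>z / f\<^sup>k\<close> is the
  image of \<open>w\<close>. The rule that sends
  \<open>b + r f\<^sup>k\<^sup>+\<^sup>l\<close> to \<open>r f\<^sup>l z\<close> is well defined on the ideal \<open>B + (f\<^sup>k\<^sup>+\<^sup>l)\<close> as soon as
  \<open>B : f\<^sup>k\<^sup>+\<^sup>l = B : f\<^sup>l\<close>, which the ascending chain condition provides for large \<open>l\<close>; injectivity
  represents this map by the multiples of an element \<open>w\<close>.\<close>

lemma torsion_divisible:
  assumes E: "injective_module R E" and acc: "acc_on (\<lambda>K. ideal K R)"
    and B: "ideal B R" and z: "z \<in> carrier E" and Bz: "\<And>b. b \<in> B \<Longrightarrow> b \<odot>\<^bsub>E\<^esub> z = \<zero>\<^bsub>E\<^esub>"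
    and f: "f \<in> carrier R"
  shows "\<exists>l::nat. \<exists>w\<in>carrier E. (\<forall>b\<in>B. b \<odot>\<^bsub>E\<^esub> w = \<zero>\<^bsub>E\<^esub>) \<and>
    (f [^]\<^bsub>R\<^esub> (k + l)) \<odot>\<^bsub>E\<^esub> w = (f [^]\<^bsub>R\<^esub> l) \<odot>\<^bsub>E\<^esub> z"
proof -
  interpret E: module R E using E by (simp add: injective_module_def)
  interpret B: ideal B R by fact
  note B_closed = B.zero_closed B.a_closed B.I_l_closed B.Icarr
  let ?colon = "\<lambda>l::nat. {r \<in> carrier R. (f [^]\<^bsub>R\<^esub> l) \<otimes>\<^bsub>R\<^esub> r \<in> B}"
  have "ideal (?colon l) R" for l
  proof (intro idealI E.R.ring_axioms E.R.add.subgroupI)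
    show "?colon l \<noteq> {}" using f B_closed by (auto intro!: exI[of _ "\<zero>\<^bsub>R\<^esub>"])
  next
    fix a r assume ar: "a \<in> ?colon l" "r \<in> carrier R"
    have "(f [^]\<^bsub>R\<^esub> l) \<otimes>\<^bsub>R\<^esub> (r \<otimes>\<^bsub>R\<^esub> a) = r \<otimes>\<^bsub>R\<^esub> ((f [^]\<^bsub>R\<^esub> l) \<otimes>\<^bsub>R\<^esub> a)"
      using ar f by (simp add: E.R.m_lcomm)
    then show "r \<otimes>\<^bsub>R\<^esub> a \<in> ?colon l" using ar f B_closed by simp
    then show "a \<otimes>\<^bsub>R\<^esub> r \<in> ?colon l" using ar by (simp add: E.R.m_comm)
  qed (use f B_closed in \<open>auto simp: E.R.r_distr E.R.r_minus B.a_inv_closed\<close>)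
  moreover have "mono ?colon"
  proof (rule incseq_SucI, rule subsetI)
    fix l r assume r: "r \<in> ?colon l"
    have "(f [^]\<^bsub>R\<^esub> Suc l) \<otimes>\<^bsub>R\<^esub> r = f \<otimes>\<^bsub>R\<^esub> ((f [^]\<^bsub>R\<^esub> l) \<otimes>\<^bsub>R\<^esub> r)"
      using r f by (simp add: E.R.m_ac)
    then show "r \<in> ?colon (Suc l)" using r f B_closed by auto
  qed
  ultimately have "\<exists>l. \<forall>j. ?colon j \<subseteq> ?colon l" by (rule acc_onD[OF acc])
  then obtain l where l: "\<And>j. ?colon j \<subseteq> ?colon l" by blast
  \<comment> \<open>\<open>F\<close> generates, together with \<open>B\<close>, the ideal \<open>C\<close> on which the map is defined\<close>
  define F where "F = f [^]\<^bsub>R\<^esub> (k + l)"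
  have F: "F \<in> carrier R" using f by (simp add: F_def)
  define C where "C = B <+>\<^bsub>R\<^esub> (PIdl\<^bsub>R\<^esub> F)"
  have idealC: "ideal C R"
    unfolding C_def by (intro E.R.add_ideals B E.R.cgenideal_ideal F)
  have C_iff: "c \<in> C \<longleftrightarrow> (\<exists>b\<in>B. \<exists>r\<in>carrier R. c = b \<oplus>\<^bsub>R\<^esub> r \<otimes>\<^bsub>R\<^esub> F)" for c
    unfolding C_def cgenideal_def set_add_def' by blast
  have well_defined: "(f [^]\<^bsub>R\<^esub> l \<otimes>\<^bsub>R\<^esub> r) \<odot>\<^bsub>E\<^esub> z = (f [^]\<^bsub>R\<^esub> l \<otimes>\<^bsub>R\<^esub> s) \<odot>\<^bsub>E\<^esub> z"
    if "b \<in> B" "a \<in> B" "r \<in> carrier R" "s \<in> carrier R"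
      and eq: "b \<oplus>\<^bsub>R\<^esub> r \<otimes>\<^bsub>R\<^esub> F = a \<oplus>\<^bsub>R\<^esub> s \<otimes>\<^bsub>R\<^esub> F" for a b r s
  proof -
    have ba: "b \<in> carrier R" "a \<in> carrier R" using that B.Icarr by auto
    note rs = that(3,4)
    have "F \<otimes>\<^bsub>R\<^esub> (r \<ominus>\<^bsub>R\<^esub> s) = r \<otimes>\<^bsub>R\<^esub> F \<ominus>\<^bsub>R\<^esub> s \<otimes>\<^bsub>R\<^esub> F"
      using rs F by (simp add: a_minus_def E.R.r_distr E.R.r_minus E.R.m_comm)
    also have "\<dots> = (b \<oplus>\<^bsub>R\<^esub> r \<otimes>\<^bsub>R\<^esub> F) \<ominus>\<^bsub>R\<^esub> s \<otimes>\<^bsub>R\<^esub> F \<ominus>\<^bsub>R\<^esub> b"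
      using rs F ba by algebra
    also have "\<dots> = a \<ominus>\<^bsub>R\<^esub> b"
      unfolding eq using rs F ba by algebra
    also have "\<dots> \<in> B" using that(1,2) by (simp add: a_minus_def B.a_closed B.a_inv_closed)
    finally have "r \<ominus>\<^bsub>R\<^esub> s \<in> ?colon (k + l)" using rs by (simp add: F_def)
    then have "f [^]\<^bsub>R\<^esub> l \<otimes>\<^bsub>R\<^esub> (r \<ominus>\<^bsub>R\<^esub> s) \<in> B" using l by blast
    then have 0: "(f [^]\<^bsub>R\<^esub> l \<otimes>\<^bsub>R\<^esub> (r \<ominus>\<^bsub>R\<^esub> s)) \<odot>\<^bsub>E\<^esub> z = \<zero>\<^bsub>E\<^esub>" by (rule Bz)
    have "f [^]\<^bsub>R\<^esub> l \<otimes>\<^bsub>R\<^esub> r = f [^]\<^bsub>R\<^esub> l \<otimes>\<^bsub>R\<^esub> (r \<ominus>\<^bsub>R\<^esub> s) \<oplus>\<^bsub>R\<^esub> f [^]\<^bsub>R\<^esub> l \<otimes>\<^bsub>R\<^esub> s"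
      using rs f E.R.nat_pow_closed[OF f, of l] by algebra
    then show ?thesis using 0 rs f z by (simp add: E.smult_l_distr)
  qed
  \<comment> \<open>by \<open>well_defined\<close> any choice of the coefficient of \<open>F\<close> gives the same value\<close>
  define rep where "rep = (\<lambda>c. SOME r. r \<in> carrier R \<and> (\<exists>b\<in>B. c = b \<oplus>\<^bsub>R\<^esub> r \<otimes>\<^bsub>R\<^esub> F))"
  define g where "g = (\<lambda>c. (f [^]\<^bsub>R\<^esub> l \<otimes>\<^bsub>R\<^esub> rep c) \<odot>\<^bsub>E\<^esub> z)"
  have g: "g (b \<oplus>\<^bsub>R\<^esub> r \<otimes>\<^bsub>R\<^esub> F) = (f [^]\<^bsub>R\<^esub> l \<otimes>\<^bsub>R\<^esub> r) \<odot>\<^bsub>E\<^esub> z"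
    if "b \<in> B" "r \<in> carrier R" for b r
  proof -
    let ?c = "b \<oplus>\<^bsub>R\<^esub> r \<otimes>\<^bsub>R\<^esub> F"
    have "rep ?c \<in> carrier R \<and> (\<exists>a\<in>B. ?c = a \<oplus>\<^bsub>R\<^esub> rep ?c \<otimes>\<^bsub>R\<^esub> F)"
      unfolding rep_def by (rule someI[of _ r]) (use that in blast)
    then obtain a where "rep ?c \<in> carrier R" "a \<in> B" "?c = a \<oplus>\<^bsub>R\<^esub> rep ?c \<otimes>\<^bsub>R\<^esub> F" by blast
    from well_defined[OF that(1) this(2) that(2) this(1,3)] show ?thesis by (simp add: g_def)
  qed
  have "\<exists>w\<in>carrier E. \<forall>c\<in>C. c \<odot>\<^bsub>E\<^esub> w = g c"
  proof (rule injective_module_extends[OF E idealC, of g])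
    fix c assume "c \<in> C"
    then show "g c \<in> carrier E" using g f z unfolding C_iff by auto
  next
    fix c d assume "c \<in> C" "d \<in> C"
    then obtain b r a s where br: "b \<in> B" "r \<in> carrier R" "c = b \<oplus>\<^bsub>R\<^esub> r \<otimes>\<^bsub>R\<^esub> F"
      and as: "a \<in> B" "s \<in> carrier R" "d = a \<oplus>\<^bsub>R\<^esub> s \<otimes>\<^bsub>R\<^esub> F" unfolding C_iff by blast
    have "b \<in> carrier R" "a \<in> carrier R" using br as B.Icarr by auto
    then have "c \<oplus>\<^bsub>R\<^esub> d = (b \<oplus>\<^bsub>R\<^esub> a) \<oplus>\<^bsub>R\<^esub> (r \<oplus>\<^bsub>R\<^esub> s) \<otimes>\<^bsub>R\<^esub> F"
      using br as F by (simp add: E.R.l_distr E.R.a_ac)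
    then show "g (c \<oplus>\<^bsub>R\<^esub> d) = g c \<oplus>\<^bsub>E\<^esub> g d"
      using br as f z g by (simp add: B.a_closed E.R.r_distr E.smult_l_distr)
  next
    fix t c assume t: "t \<in> carrier R" and "c \<in> C"
    then obtain b r where br: "b \<in> B" "r \<in> carrier R" "c = b \<oplus>\<^bsub>R\<^esub> r \<otimes>\<^bsub>R\<^esub> F"
      unfolding C_iff by blast
    then have "t \<otimes>\<^bsub>R\<^esub> c = t \<otimes>\<^bsub>R\<^esub> b \<oplus>\<^bsub>R\<^esub> (t \<otimes>\<^bsub>R\<^esub> r) \<otimes>\<^bsub>R\<^esub> F"
      using t F B.Icarr by (simp add: E.R.r_distr E.R.m_assoc)
    then have "g (t \<otimes>\<^bsub>R\<^esub> c) = (f [^]\<^bsub>R\<^esub> l \<otimes>\<^bsub>R\<^esub> (t \<otimes>\<^bsub>R\<^esub> r)) \<odot>\<^bsub>E\<^esub> z"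
      using t br g[of "t \<otimes>\<^bsub>R\<^esub> b" "t \<otimes>\<^bsub>R\<^esub> r"] by (simp add: B.I_l_closed)
    also have "f [^]\<^bsub>R\<^esub> l \<otimes>\<^bsub>R\<^esub> (t \<otimes>\<^bsub>R\<^esub> r) = t \<otimes>\<^bsub>R\<^esub> (f [^]\<^bsub>R\<^esub> l \<otimes>\<^bsub>R\<^esub> r)"
      using t br f by (simp add: E.R.m_lcomm)
    also have "\<dots> \<odot>\<^bsub>E\<^esub> z = t \<odot>\<^bsub>E\<^esub> g c"
      using t br f z g by (simp add: E.smult_assoc1)
    finally show "g (t \<otimes>\<^bsub>R\<^esub> c) = t \<odot>\<^bsub>E\<^esub> g c" .
  qed
  then obtain w where w: "w \<in> carrier E" "\<And>c. c \<in> C \<Longrightarrow> c \<odot>\<^bsub>E\<^esub> w = g c" by blast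
  show ?thesis
  proof (intro exI[of _ l] bexI[of _ w] conjI ballI)
    show "w \<in> carrier E" by fact
  next
    fix b assume b: "b \<in> B"
    then have "b = b \<oplus>\<^bsub>R\<^esub> \<zero>\<^bsub>R\<^esub> \<otimes>\<^bsub>R\<^esub> F" using F B.Icarr by simp
    then have "b \<in> C" "g b = (f [^]\<^bsub>R\<^esub> l \<otimes>\<^bsub>R\<^esub> \<zero>\<^bsub>R\<^esub>) \<odot>\<^bsub>E\<^esub> z"
      using b g[of b "\<zero>\<^bsub>R\<^esub>"] unfolding C_iff by (blast, simp)
    then show "b \<odot>\<^bsub>E\<^esub> w = \<zero>\<^bsub>E\<^esub>" using w f z by simp
  next
    have F1: "F = \<zero>\<^bsub>R\<^esub> \<oplus>\<^bsub>R\<^esub> \<one>\<^bsub>R\<^esub> \<otimes>\<^bsub>R\<^esub> F" using F by simp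
    then have "F \<in> C" unfolding C_iff using B.zero_closed by blast
    moreover have "g F = (f [^]\<^bsub>R\<^esub> l) \<odot>\<^bsub>E\<^esub> z"
      using g[OF B.zero_closed E.R.one_closed] F1 f by simp
    ultimately show "(f [^]\<^bsub>R\<^esub> (k + l)) \<odot>\<^bsub>E\<^esub> w = (f [^]\<^bsub>R\<^esub> l) \<odot>\<^bsub>E\<^esub> z"
      using w by (simp add: F_def)
  qed
qed

section \<open>Vanishing above the number of generators\<close>

definition power_torsion :: "('a, 'b) ring_scheme \<Rightarrow> ('a, 'm) module \<Rightarrow> 'a list \<Rightarrow> 'm \<Rightarrow> bool" where
  "power_torsion R M fs x \<longleftrightarrow> (\<forall>f\<in>set fs. \<exists>k::nat. (f [^]\<^bsub>R\<^esub> k) \<odot>\<^bsub>M\<^esub> x = \<zero>\<^bsub>M\<^esub>)"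

lemma power_annihilates_mono:
  assumes "module R M" "x \<in> carrier M" "f \<in> carrier R"
    and "(f [^]\<^bsub>R\<^esub> k) \<odot>\<^bsub>M\<^esub> x = \<zero>\<^bsub>M\<^esub>" "k \<le> (j::nat)"
  shows "(f [^]\<^bsub>R\<^esub> j) \<odot>\<^bsub>M\<^esub> x = \<zero>\<^bsub>M\<^esub>"
proof -
  interpret M: module R M by fact
  have "f [^]\<^bsub>R\<^esub> j = (f [^]\<^bsub>R\<^esub> (j - k)) \<otimes>\<^bsub>R\<^esub> (f [^]\<^bsub>R\<^esub> k)"
    using assms(3,5) by (simp add: M.R.nat_pow_mult)
  then show ?thesis using assms by (simp add: M.smult_assoc1)
qed

lemma power_torsion_add:
  assumes M: "module R M" and fs: "set fs \<subseteq> carrier R" and xy: "x \<in> carrier M" "y \<in> carrier M"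
    and "power_torsion R M fs x" "power_torsion R M fs y"
  shows "power_torsion R M fs (x \<oplus>\<^bsub>M\<^esub> y)"
  unfolding power_torsion_def
proof
  interpret M: module R M by fact
  fix f assume f: "f \<in> set fs"
  then obtain j k :: nat where jk: "(f [^]\<^bsub>R\<^esub> j) \<odot>\<^bsub>M\<^esub> x = \<zero>\<^bsub>M\<^esub>" "(f [^]\<^bsub>R\<^esub> k) \<odot>\<^bsub>M\<^esub> y = \<zero>\<^bsub>M\<^esub>"
    using assms(5,6) unfolding power_torsion_def by blast
  have fR: "f \<in> carrier R" using f fs by auto
  have "(f [^]\<^bsub>R\<^esub> max j k) \<odot>\<^bsub>M\<^esub> (x \<oplus>\<^bsub>M\<^esub> y) = \<zero>\<^bsub>M\<^esub>"
    using power_annihilates_mono[OF M xy(1) fR jk(1), of "max j k"]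
      power_annihilates_mono[OF M xy(2) fR jk(2), of "max j k"] fR xy
    by (simp add: M.smult_r_distr)
  then show "\<exists>k::nat. (f [^]\<^bsub>R\<^esub> k) \<odot>\<^bsub>M\<^esub> (x \<oplus>\<^bsub>M\<^esub> y) = \<zero>\<^bsub>M\<^esub>" by blast
qed

lemma power_torsion_smult:
  assumes M: "module R M" and fs: "set fs \<subseteq> carrier R" and x: "x \<in> carrier M" "r \<in> carrier R"
    and "power_torsion R M fs x"
  shows "power_torsion R M fs (r \<odot>\<^bsub>M\<^esub> x)"
  unfolding power_torsion_def
proof
  interpret M: module R M by fact
  fix f assume f: "f \<in> set fs"
  then obtain j :: nat where j: "(f [^]\<^bsub>R\<^esub> j) \<odot>\<^bsub>M\<^esub> x = \<zero>\<^bsub>M\<^esub>"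
    using assms(5) unfolding power_torsion_def by blast
  have "f \<in> carrier R" using f fs by auto
  then have "(f [^]\<^bsub>R\<^esub> j) \<odot>\<^bsub>M\<^esub> (r \<odot>\<^bsub>M\<^esub> x) = r \<odot>\<^bsub>M\<^esub> ((f [^]\<^bsub>R\<^esub> j) \<odot>\<^bsub>M\<^esub> x)"
    using x by (simp add: M.smult_assoc1[symmetric] M.R.m_comm)
  then show "\<exists>k::nat. (f [^]\<^bsub>R\<^esub> k) \<odot>\<^bsub>M\<^esub> (r \<odot>\<^bsub>M\<^esub> x) = \<zero>\<^bsub>M\<^esub>" using j x by auto
qed

lemma mod_homD:
  assumes "h \<in> mod_hom R M N"
  shows "x \<in> carrier M \<Longrightarrow> h x \<in> carrier N"
    "x \<in> carrier M \<Longrightarrow> y \<in> carrier M \<Longrightarrow> h (x \<oplus>\<^bsub>M\<^esub> y) = h x \<oplus>\<^bsub>N\<^esub> h y"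
    "r \<in> carrier R \<Longrightarrow> x \<in> carrier M \<Longrightarrow> h (r \<odot>\<^bsub>M\<^esub> x) = r \<odot>\<^bsub>N\<^esub> h x"
  using assms by (auto simp: mod_hom_def)

lemma mod_hom_zero:
  assumes "module R M" "module R N" "h \<in> mod_hom R M N"
  shows "h \<zero>\<^bsub>M\<^esub> = \<zero>\<^bsub>N\<^esub>"
proof -
  interpret M: module R M by fact
  interpret N: module R N by fact
  have "h (\<zero>\<^bsub>R\<^esub> \<odot>\<^bsub>M\<^esub> \<zero>\<^bsub>M\<^esub>) = \<zero>\<^bsub>R\<^esub> \<odot>\<^bsub>N\<^esub> h \<zero>\<^bsub>M\<^esub>"
    by (rule mod_homD(3)[OF assms(3)]) auto
  then show ?thesis using mod_homD(1)[OF assms(3)] by simp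
qed

lemma power_torsion_mod_hom:
  assumes "module R M" "module R N" "h \<in> mod_hom R M N" "set fs \<subseteq> carrier R" "x \<in> carrier M"
    and "power_torsion R M fs x"
  shows "power_torsion R N fs (h x)"
  unfolding power_torsion_def
proof
  interpret M: module R M by fact
  fix f assume f: "f \<in> set fs"
  then obtain k :: nat where k: "(f [^]\<^bsub>R\<^esub> k) \<odot>\<^bsub>M\<^esub> x = \<zero>\<^bsub>M\<^esub>"
    using assms(6) unfolding power_torsion_def by blast
  have "f [^]\<^bsub>R\<^esub> k \<in> carrier R" using f assms(4) by auto
  then have "(f [^]\<^bsub>R\<^esub> k) \<odot>\<^bsub>N\<^esub> h x = \<zero>\<^bsub>N\<^esub>"
    using mod_homD(3)[OF assms(3) _ assms(5), of "f [^]\<^bsub>R\<^esub> k"] k mod_hom_zero[OF assms(1-3)] by simp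
  then show "\<exists>k::nat. (f [^]\<^bsub>R\<^esub> k) \<odot>\<^bsub>N\<^esub> h x = \<zero>\<^bsub>N\<^esub>" by blast
qed

lemma injective_resolutionD:
  assumes "injective_resolution R M \<epsilon> I \<delta>"
  shows "injective_module R (I i)" "module R (I i)" "\<delta> i \<in> mod_hom R (I i) (I (i + 1))"
    "i < 0 \<Longrightarrow> carrier (I i) = {\<zero>\<^bsub>I i\<^esub>}"
    "i > 0 \<Longrightarrow> \<delta> (i - 1) ` carrier (I (i - 1)) = {x \<in> carrier (I i). \<delta> i x = \<zero>\<^bsub>I (i + 1)\<^esub>}"
  using assms by (simp_all add: injective_resolution_def injective_module_def a_kernel_def')

text \<open>Local cohomology supported at \<open>f\<^sub>1, \<dots>, f\<^sub>m\<close> vanishes in degrees above \<open>m\<close>. The induction adds one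
  element \<open>f\<close> to the list and follows the exact sequence
  \<open>0 \<rightarrow> \<Gamma>\<^sub>f(\<Gamma>(I)) \<rightarrow> \<Gamma>(I) \<rightarrow> \<Gamma>(I)\<^sub>f \<rightarrow> 0\<close>, where \<open>\<Gamma>\<close> is the torsion for the shorter list. A
  cocycle \<open>x\<close> with \<open>f\<^sup>k x = 0\<close> is the boundary of some \<open>y\<close> that is torsion for the shorter list. Then
  \<open>f\<^sup>k y\<close> is a cocycle one degree lower, hence the boundary of some \<open>z\<close>, and dividing \<open>z\<close> by
  \<open>f\<^sup>k\<close> gives \<open>w\<close> such that \<open>y - \<delta> w\<close> is also \<open>f\<close>-torsion.\<close>

lemma power_torsion_cocycle_is_coboundary:
  assumes res: "injective_resolution R M \<epsilon> I \<delta>" and acc: "acc_on (\<lambda>K. ideal K R)"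
    and "set fs \<subseteq> carrier R" "int (length fs) < i"
    and "x \<in> carrier (I i)" "\<delta> i x = \<zero>\<^bsub>I (i + 1)\<^esub>" "power_torsion R (I i) fs x"
  shows "\<exists>y\<in>carrier (I (i - 1)). power_torsion R (I (i - 1)) fs y \<and> \<delta> (i - 1) y = x"
  using assms(3-)
proof (induction fs arbitrary: i x)
  case Nil
  then have "x \<in> \<delta> (i - 1) ` carrier (I (i - 1))"
    using injective_resolutionD(5)[OF res, of i] by simp
  then show ?case by (auto simp: power_torsion_def)
next
  case (Cons f fs)
  note mod = injective_resolutionD(2)[OF res]
  interpret Ii: module R "I i" by (rule mod)
  interpret Ii1: module R "I (i - 1)" by (rule mod)
  interpret Ii2: module R "I (i - 2)" by (rule mod)
  have hom1: "\<delta> (i - 1) \<in> mod_hom R (I (i - 1)) (I i)"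
    using injective_resolutionD(3)[OF res, of "i - 1"] by simp
  have hom2: "\<delta> (i - 2) \<in> mod_hom R (I (i - 2)) (I (i - 1))"
    using injective_resolutionD(3)[OF res, of "i - 2"] by (simp add: algebra_simps)
  have f: "f \<in> carrier R" and fs: "set fs \<subseteq> carrier R" using Cons.prems by auto
  have tors: "power_torsion R (I i) fs x" using Cons.prems(5) by (auto simp: power_torsion_def)
  obtain k :: nat where k: "(f [^]\<^bsub>R\<^esub> k) \<odot>\<^bsub>I i\<^esub> x = \<zero>\<^bsub>I i\<^esub>"
    using Cons.prems(5) by (auto simp: power_torsion_def)
  have len: "int (length fs) < i" "int (length fs) < i - 1" using Cons.prems(2) by auto
  obtain y where y: "y \<in> carrier (I (i - 1))" "power_torsion R (I (i - 1)) fs y" "\<delta> (i - 1) y = x"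
    using Cons.IH[OF fs len(1) Cons.prems(3,4) tors] by blast
  let ?y' = "(f [^]\<^bsub>R\<^esub> k) \<odot>\<^bsub>I (i - 1)\<^esub> y"
  have "\<delta> (i - 1) ?y' = \<zero>\<^bsub>I i\<^esub>"
    using mod_homD(3)[OF hom1, of "f [^]\<^bsub>R\<^esub> k" y] f y k by simp
  then have "\<exists>z\<in>carrier (I (i - 1 - 1)). power_torsion R (I (i - 1 - 1)) fs z \<and> \<delta> (i - 1 - 1) z = ?y'"
    using f y fs by (intro Cons.IH[OF fs len(2)] power_torsion_smult[OF mod]) auto
  then obtain z where z: "z \<in> carrier (I (i - 2))" "power_torsion R (I (i - 2)) fs z" "\<delta> (i - 2) z = ?y'"
    by auto
  \<comment> \<open>dividing inside the elements that the annihilator of \<open>z\<close> kills keeps the torsion of \<open>z\<close>\<close>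
  let ?ann = "annihilator R (I (i - 2))"
  have "\<exists>l::nat. \<exists>w\<in>carrier (I (i - 2)). (\<forall>b\<in>?ann z. b \<odot>\<^bsub>I (i - 2)\<^esub> w = \<zero>\<^bsub>I (i - 2)\<^esub>) \<and>
      (f [^]\<^bsub>R\<^esub> (k + l)) \<odot>\<^bsub>I (i - 2)\<^esub> w = (f [^]\<^bsub>R\<^esub> l) \<odot>\<^bsub>I (i - 2)\<^esub> z"
    by (rule torsion_divisible[OF injective_resolutionD(1)[OF res] acc
          ideal_annihilator[OF mod z(1)] z(1) _ f]) (simp add: annihilator_def)
  then obtain l w where w: "w \<in> carrier (I (i - 2))"
    "\<And>b. b \<in> ?ann z \<Longrightarrow> b \<odot>\<^bsub>I (i - 2)\<^esub> w = \<zero>\<^bsub>I (i - 2)\<^esub>"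
    "(f [^]\<^bsub>R\<^esub> (k + l)) \<odot>\<^bsub>I (i - 2)\<^esub> w = (f [^]\<^bsub>R\<^esub> l) \<odot>\<^bsub>I (i - 2)\<^esub> z"
    by (elim exE bexE conjE) (rule that, assumption, erule bspec, assumption+)
  have w_tors: "power_torsion R (I (i - 2)) fs w"
    unfolding power_torsion_def
  proof
    fix g assume g: "g \<in> set fs"
    then obtain j :: nat where "(g [^]\<^bsub>R\<^esub> j) \<odot>\<^bsub>I (i - 2)\<^esub> z = \<zero>\<^bsub>I (i - 2)\<^esub>"
      using z(2) unfolding power_torsion_def by blast
    then have "g [^]\<^bsub>R\<^esub> j \<in> ?ann z" using g fs by (auto simp: annihilator_def)
    from w(2)[OF this] show "\<exists>j::nat. (g [^]\<^bsub>R\<^esub> j) \<odot>\<^bsub>I (i - 2)\<^esub> w = \<zero>\<^bsub>I (i - 2)\<^esub>" ..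
  qed
  let ?m1 = "\<ominus>\<^bsub>R\<^esub> \<one>\<^bsub>R\<^esub>"
  let ?dw = "\<delta> (i - 2) w"
  \<comment> \<open>\<open>?v = y - \<delta> w\<close>, written with addition and scalar multiplication, which homomorphisms preserve\<close>
  let ?v = "y \<oplus>\<^bsub>I (i - 1)\<^esub> ?m1 \<odot>\<^bsub>I (i - 1)\<^esub> ?dw"
  have dw: "?dw \<in> carrier (I (i - 1))" by (rule mod_homD(1)[OF hom2 w(1)])
  have v: "?v \<in> carrier (I (i - 1))" using y dw by simp
  have "?dw \<in> {x \<in> carrier (I (i - 1)). \<delta> (i - 1) x = \<zero>\<^bsub>I (i - 1 + 1)\<^esub>}"
    using injective_resolutionD(5)[OF res, of "i - 1"] len w(1) by auto
  then have ddw: "\<delta> (i - 1) ?dw = \<zero>\<^bsub>I i\<^esub>" by simp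
  have "\<delta> (i - 1) ?v = x"
    using y dw ddw Cons.prems(3)
    by (simp add: mod_homD(2)[OF hom1] mod_homD(3)[OF hom1])
  moreover have "power_torsion R (I (i - 1)) fs ?v"
    using fs y dw
    by (intro power_torsion_add[OF mod] power_torsion_smult[OF mod]
        power_torsion_mod_hom[OF mod mod hom2 fs w(1) w_tors]) auto
  moreover have "(f [^]\<^bsub>R\<^esub> (k + l)) \<odot>\<^bsub>I (i - 1)\<^esub> ?v = \<zero>\<^bsub>I (i - 1)\<^esub>"
  proof -
    let ?F = "f [^]\<^bsub>R\<^esub> (k + l)"
    have F: "?F \<in> carrier R" using f by simp
    have "?F = (f [^]\<^bsub>R\<^esub> l) \<otimes>\<^bsub>R\<^esub> (f [^]\<^bsub>R\<^esub> k)"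
      using f by (simp add: Ii.R.nat_pow_mult add.commute)
    then have "?F \<odot>\<^bsub>I (i - 1)\<^esub> y = (f [^]\<^bsub>R\<^esub> l) \<odot>\<^bsub>I (i - 1)\<^esub> \<delta> (i - 2) z"
      using f y z by (simp add: Ii1.smult_assoc1)
    also have "\<dots> = \<delta> (i - 2) ((f [^]\<^bsub>R\<^esub> l) \<odot>\<^bsub>I (i - 2)\<^esub> z)"
      using f z mod_homD(3)[OF hom2] by simp
    also have "\<dots> = \<delta> (i - 2) (?F \<odot>\<^bsub>I (i - 2)\<^esub> w)" using w(3) by simp
    also have "\<dots> = ?F \<odot>\<^bsub>I (i - 1)\<^esub> ?dw" using mod_homD(3)[OF hom2 F w(1)] .
    finally have eq: "?F \<odot>\<^bsub>I (i - 1)\<^esub> y = ?F \<odot>\<^bsub>I (i - 1)\<^esub> ?dw" .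
    have "?F \<odot>\<^bsub>I (i - 1)\<^esub> (?m1 \<odot>\<^bsub>I (i - 1)\<^esub> ?dw) = ?m1 \<odot>\<^bsub>I (i - 1)\<^esub> (?F \<odot>\<^bsub>I (i - 1)\<^esub> ?dw)"
      using F dw by (simp add: Ii1.smult_assoc1[symmetric] Ii.R.m_comm)
    then have "?F \<odot>\<^bsub>I (i - 1)\<^esub> ?v =
        ?F \<odot>\<^bsub>I (i - 1)\<^esub> ?dw \<oplus>\<^bsub>I (i - 1)\<^esub> ?m1 \<odot>\<^bsub>I (i - 1)\<^esub> (?F \<odot>\<^bsub>I (i - 1)\<^esub> ?dw)"
      using F y dw eq by (simp add: Ii1.smult_r_distr)
    also have "\<dots> = \<zero>\<^bsub>I (i - 1)\<^esub>"
      using F dw by (simp add: Ii1.smult_l_minus Ii1.M.r_neg)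
    finally show ?thesis .
  qed
  ultimately show ?case using v by (intro bexI[of _ ?v]) (auto simp: power_torsion_def)
qed

section \<open>Torsion with respect to an ideal\<close>

lemma ideals_set_simps [simp]:
  "\<one>\<^bsub>ideals_set R\<^esub> = carrier R" "I \<otimes>\<^bsub>ideals_set R\<^esub> J = ideal_prod R I J"
  by (simp_all add: ideals_set_def)

lemma (in ring) ideal_ideals_set_pow:
  assumes "ideal J R"
  shows "ideal (J [^]\<^bsub>ideals_set R\<^esub> (t::nat)) R"
  using assms by (induction t) (simp_all add: oneideal ideal_prod_is_ideal)

lemma (in ring) ideals_set_pow_antimono:
  assumes "ideal J R" "s \<le> (t::nat)"
  shows "J [^]\<^bsub>ideals_set R\<^esub> t \<subseteq> J [^]\<^bsub>ideals_set R\<^esub> s"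
  using assms(2)
proof (induction t rule: dec_induct)
  case (step t)
  then show ?case
    using ideal_prod_inter[OF ideal_ideals_set_pow[OF assms(1), of t] assms(1)]
    by auto
qed simp

lemma (in ring) pow_in_ideals_set_pow:
  assumes "f \<in> J" "J \<subseteq> carrier R"
  shows "f [^] t \<in> J [^]\<^bsub>ideals_set R\<^esub> (t::nat)"
proof (induction t)
  case (Suc t)
  then show ?case using assms ideal_prod.prod[of "f [^] t" "J [^]\<^bsub>ideals_set R\<^esub> t" f J R]
    by simp
qed simp

definition ideal_torsion :: "('a, 'b) ring_scheme \<Rightarrow> ('a, 'm) module \<Rightarrow> 'a set \<Rightarrow> 'm \<Rightarrow> bool" where
  "ideal_torsion R M J x \<longleftrightarrow>
     (\<exists>t::nat. \<forall>r \<in> J [^]\<^bsub>ideals_set R\<^esub> t. r \<odot>\<^bsub>M\<^esub> x = \<zero>\<^bsub>M\<^esub>)"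

text \<open>If powers of the finitely many generators of \<open>J\<close> annihilate \<open>x\<close> then so does a power of \<open>J\<close>.
  The induction is on the sum of the exponents. Multiplying \<open>x\<close> by a generator lowers this sum by
  one, hence a common power \<open>J\<^sup>t\<close> annihilates all these multiples, and \<open>J\<^sup>t\<^sup>+\<^sup>1\<close> annihilates \<open>x\<close>.
  If an exponent is zero then \<open>x = 0\<close>.\<close>

lemma ideal_torsionI_generators:
  fixes R :: "('a, 'b) ring_scheme" and M :: "('a, 'm) module"
  assumes M: "module R M" and J: "ideal J R" and G: "finite G" "G \<subseteq> carrier R" "J \<subseteq> Idl\<^bsub>R\<^esub> G"
    and x: "x \<in> carrier M" and "\<And>g. g \<in> G \<Longrightarrow> \<exists>k::nat. (g [^]\<^bsub>R\<^esub> k) \<odot>\<^bsub>M\<^esub> x = \<zero>\<^bsub>M\<^esub>"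
  shows "ideal_torsion R M J x"
proof -
  interpret M: module R M by fact
  from assms(7) obtain N where "\<And>g. g \<in> G \<Longrightarrow> (g [^]\<^bsub>R\<^esub> (N g :: nat)) \<odot>\<^bsub>M\<^esub> x = \<zero>\<^bsub>M\<^esub>"
    by metis
  then show ?thesis using x
  proof (induction "sum N G" arbitrary: N x rule: less_induct)
    case less
    show ?case
    proof (cases "\<exists>g\<in>G. N g = 0")
      case True
      then obtain g where g: "g \<in> G" "N g = 0" by blast
      then have "x = \<zero>\<^bsub>M\<^esub>" using less.prems(1)[OF g(1)] less.prems(2) by simp
      then show ?thesis unfolding ideal_torsion_def
        by (intro exI[of _ 0]) simp
    next
      case False
      have "ideal_torsion R M J (g \<odot>\<^bsub>M\<^esub> x)" if g: "g \<in> G" for g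
      proof (rule less.hyps)
        have gR: "g \<in> carrier R" using g G by auto
        have Ng: "N g \<noteq> 0" using g False by auto
        show "sum (N(g := N g - 1)) G < sum N G"
          using g Ng G(1) by (intro sum_strict_mono_ex1) auto
        show "g \<odot>\<^bsub>M\<^esub> x \<in> carrier M" using gR less.prems(2) by simp
        fix h assume h: "h \<in> G"
        have hR: "h \<in> carrier R" using h G by auto
        show "(h [^]\<^bsub>R\<^esub> ((N(g := N g - 1)) h)) \<odot>\<^bsub>M\<^esub> (g \<odot>\<^bsub>M\<^esub> x) = \<zero>\<^bsub>M\<^esub>"
        proof (cases "h = g")
          case True
          have "g [^]\<^bsub>R\<^esub> N g = (g [^]\<^bsub>R\<^esub> (N g - 1)) \<otimes>\<^bsub>R\<^esub> g"
            using Ng by (cases "N g") simp_all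
          then show ?thesis
            using less.prems(1)[OF g] less.prems(2) gR True by (simp add: M.smult_assoc1)
        next
          case False
          have "(h [^]\<^bsub>R\<^esub> N h) \<odot>\<^bsub>M\<^esub> (g \<odot>\<^bsub>M\<^esub> x) = g \<odot>\<^bsub>M\<^esub> ((h [^]\<^bsub>R\<^esub> N h) \<odot>\<^bsub>M\<^esub> x)"
            using hR gR less.prems(2) by (simp add: M.smult_assoc1[symmetric] M.R.m_comm)
          then show ?thesis using False less.prems(1)[OF h] gR by simp
        qed
      qed
      then have "\<forall>g\<in>G. \<exists>t::nat. \<forall>r \<in> J [^]\<^bsub>ideals_set R\<^esub> t. r \<odot>\<^bsub>M\<^esub> (g \<odot>\<^bsub>M\<^esub> x) = \<zero>\<^bsub>M\<^esub>"
        by (simp add: ideal_torsion_def)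
      from bchoice[OF this] obtain T :: "'a \<Rightarrow> nat" where
        T: "\<forall>g\<in>G. \<forall>r \<in> J [^]\<^bsub>ideals_set R\<^esub> T g. r \<odot>\<^bsub>M\<^esub> (g \<odot>\<^bsub>M\<^esub> x) = \<zero>\<^bsub>M\<^esub>" ..
      \<comment> \<open>the additional \<open>0\<close> makes the maximum meaningful if there are no generators\<close>
      define t where "t = Max (insert 0 (T ` G))"
      have kills_gens: "r \<odot>\<^bsub>M\<^esub> (g \<odot>\<^bsub>M\<^esub> x) = \<zero>\<^bsub>M\<^esub>"
        if r: "r \<in> J [^]\<^bsub>ideals_set R\<^esub> t" and g: "g \<in> G" for r g
      proof -
        have "T g \<le> t" using g G(1) by (simp add: t_def)
        then show ?thesis using M.R.ideals_set_pow_antimono[OF J] r T g by blast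
      qed
      have Jt: "ideal (J [^]\<^bsub>ideals_set R\<^esub> t) R" by (rule M.R.ideal_ideals_set_pow[OF J])
      have kills: "r \<otimes>\<^bsub>R\<^esub> b \<in> annihilator R M x"
        if r: "r \<in> J [^]\<^bsub>ideals_set R\<^esub> t" and b: "b \<in> J" for r b
      proof -
        have rR: "r \<in> carrier R" using r ideal.Icarr[OF Jt] by blast
        then have rx: "r \<odot>\<^bsub>M\<^esub> x \<in> carrier M" using less.prems(2) by simp
        have "G \<subseteq> annihilator R M (r \<odot>\<^bsub>M\<^esub> x)"
        proof
          fix g assume g: "g \<in> G"
          then have gR: "g \<in> carrier R" using G by auto
          have "g \<odot>\<^bsub>M\<^esub> (r \<odot>\<^bsub>M\<^esub> x) = r \<odot>\<^bsub>M\<^esub> (g \<odot>\<^bsub>M\<^esub> x)"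
            using rR gR less.prems(2) by (simp add: M.smult_assoc1[symmetric] M.R.m_comm)
          then show "g \<in> annihilator R M (r \<odot>\<^bsub>M\<^esub> x)"
            using kills_gens[OF r g] gR by (simp add: annihilator_def)
        qed
        then have "b \<in> annihilator R M (r \<odot>\<^bsub>M\<^esub> x)"
          using M.R.genideal_minimal[OF ideal_annihilator[OF M rx]] G(3) b by blast
        then have bR: "b \<in> carrier R" and "b \<odot>\<^bsub>M\<^esub> (r \<odot>\<^bsub>M\<^esub> x) = \<zero>\<^bsub>M\<^esub>"
          by (simp_all add: annihilator_def)
        then show ?thesis
          using rR less.prems(2) M.smult_assoc1[OF bR rR less.prems(2)] M.R.m_comm[OF rR bR]
          by (simp add: annihilator_def)
      qed
      have "J [^]\<^bsub>ideals_set R\<^esub> Suc t \<subseteq> annihilator R M x"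
      proof
        fix r assume "r \<in> J [^]\<^bsub>ideals_set R\<^esub> Suc t"
        then have "r \<in> ideal_prod R (J [^]\<^bsub>ideals_set R\<^esub> t) J" by simp
        then show "r \<in> annihilator R M x"
        proof (induction r rule: ideal_prod.induct)
          case (sum a b)
          then show ?case
            using additive_subgroup.a_closed[OF ideal.axioms(1)[OF ideal_annihilator[OF M less.prems(2)]]]
            by blast
        qed (rule kills)
      qed
      then show ?thesis unfolding ideal_torsion_def annihilator_def by blast
    qed
  qed
qed

section \<open>Radicals and the lemma of Schmitt and Vogel\<close>

text \<open>In each term of the binomial expansion, \<open>p\<close> has exponent at least \<open>k\<close> or \<open>q\<close> has exponent at
  least \<open>l\<close>.\<close>

lemma ideal_of_add_in_radical:
  assumes B: "subring_of B" and A: "ideal_of B A" and pq: "p \<in> B" "q \<in> B"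
    and "p ^ k \<in> A" "q ^ l \<in> A"
  shows "(p + q) ^ (k + l) \<in> A"
proof -
  have power: "r ^ j \<in> B" if "r \<in> B" for r j
    using that by (induction j) (auto intro: subring_ofD[OF B])
  have of_nat: "of_nat j \<in> B" for j
    by (induction j) (auto intro: subring_ofD[OF B])
  have power_le: "r ^ i \<in> A" if "r \<in> B" "r ^ j \<in> A" "j \<le> i" for r i j
  proof -
    have "r ^ i = r ^ (i - j) * r ^ j" using that by (simp flip: power_add)
    then show ?thesis using ideal_ofD(4)[OF A power[OF that(1)] that(2)] by simp
  qed
  have coeff: "of_nat c * r ^ j \<in> B" if "r \<in> B" for c j r
    by (rule subring_ofD(5)[OF B of_nat power[OF that]])
  have summand: "of_nat ((k + l) choose i) * p ^ i * q ^ (k + l - i) \<in> A" for i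
  proof (cases "k \<le> i")
    case True
    have "of_nat ((k + l) choose i) * q ^ (k + l - i) * p ^ i \<in> A"
      by (rule ideal_ofD(4)[OF A coeff[OF pq(2)] power_le[OF pq(1) assms(5) True]])
    then show ?thesis by (simp add: mult_ac)
  next
    case False
    then have "l \<le> k + l - i" by simp
    then show ?thesis
      by (rule ideal_ofD(4)[OF A coeff[OF pq(1)] power_le[OF pq(2) assms(6)]])
  qed
  have "sum t S \<in> A" if "\<And>i. t i \<in> A" for t :: "nat \<Rightarrow> 'a" and S
    using that by (induction S rule: infinite_finite_induct) (auto intro: ideal_ofD[OF A])
  then show ?thesis unfolding binomial_ring using summand .
qed

lemma ideal_of_sum_in_radical:
  assumes B: "subring_of B" and A: "ideal_of B A"
    and "finite S" "\<And>i. i \<in> S \<Longrightarrow> p i \<in> B" "\<And>i. i \<in> S \<Longrightarrow> \<exists>k. p i ^ k \<in> A"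
  shows "sum p S \<in> B \<and> (\<exists>k. sum p S ^ k \<in> A)"
  using assms(3-)
proof (induction S)
  case empty
  then show ?case using ideal_ofD(2)[OF A] subring_ofD(1)[OF B] by (auto intro: exI[of _ 1])
next
  case (insert i S)
  then obtain j k where "p i ^ j \<in> A" "sum p S ^ k \<in> A" by blast
  then have "(p i + sum p S) ^ (j + k) \<in> A"
    using insert by (intro ideal_of_add_in_radical[OF B A]) auto
  then show ?case using insert subring_ofD(4)[OF B] by auto
qed

lemma ideal_of_mult_in_radical:
  assumes B: "subring_of B" and A: "ideal_of B A" and "c \<in> B" "p ^ k \<in> A"
  shows "(c * p) ^ k \<in> A"
proof -
  have "c ^ k \<in> B" using assms(3) by (induction k) (auto intro: subring_ofD[OF B])
  then show ?thesis using ideal_ofD(4)[OF A _ assms(4)] by (simp add: power_mult_distrib)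
qed

text \<open>The lemma of Schmitt and Vogel: up to radical, the elements of one rank can be replaced by their
  sum. By descending induction on the rank, products of distinct elements of rank \<open>\<rho> F\<close> already lie
  in the radical of \<open>A\<close>. Multiplying the sum of this rank by \<open>x F\<close> hence leaves \<open>(x F)\<^sup>2\<close> modulo the
  radical.\<close>

lemma schmitt_vogel:
  fixes x :: "'i \<Rightarrow> 'r::comm_ring_1" and \<rho> :: "'i \<Rightarrow> nat"
  assumes B: "subring_of B" and A: "ideal_of B A"
    and fin: "finite \<G>" and xB: "\<And>F. F \<in> \<G> \<Longrightarrow> x F \<in> B"
    and sums: "\<And>F. F \<in> \<G> \<Longrightarrow> \<exists>k. (\<Sum>G | G \<in> \<G> \<and> \<rho> G = \<rho> F. x G) ^ k \<in> A"
    and products: "\<And>F F'. F \<in> \<G> \<Longrightarrow> F' \<in> \<G> \<Longrightarrow> F \<noteq> F' \<Longrightarrow> \<rho> F = \<rho> F' \<Longrightarrow>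
      x F * x F' \<in> A \<or> (\<exists>G\<in>\<G>. \<rho> F < \<rho> G \<and> (\<exists>c\<in>B. x F * x F' = c * x G))"
    and F: "F \<in> \<G>"
  shows "\<exists>k. x F ^ k \<in> A"
  using F
proof (induction "Max (\<rho> ` \<G>) - \<rho> F" arbitrary: F rule: less_induct)
  case less
  let ?S = "{G \<in> \<G>. \<rho> G = \<rho> F}"
  let ?f = "\<Sum>G\<in>?S. x G"
  have fin_S: "finite ?S" using fin by simp
  have prod_rad: "\<exists>k. (- (x F * x G)) ^ k \<in> A" if G: "G \<in> ?S - {F}" for G
  proof -
    have "\<exists>k. (x F * x G) ^ k \<in> A"
    proof (cases "x F * x G \<in> A")
      case True
      then show ?thesis by (intro exI[of _ 1]) simp
    next
      case False
      then obtain H c where H: "H \<in> \<G>" "\<rho> F < \<rho> H" "c \<in> B" "x F * x G = c * x H"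
        using products[OF less.prems, of G] G by auto
      have "\<rho> H \<le> Max (\<rho> ` \<G>)" using fin H(1) by simp
      then have "Max (\<rho> ` \<G>) - \<rho> H < Max (\<rho> ` \<G>) - \<rho> F" using H(2) by linarith
      from less.hyps[OF this H(1)] obtain k where "x H ^ k \<in> A" ..
      from ideal_of_mult_in_radical[OF B A H(3) this] show ?thesis unfolding H(4) ..
    qed
    then obtain k where "(x F * x G) ^ k \<in> A" ..
    from ideal_of_mult_in_radical[OF B A subring_ofD(3)[OF B subring_ofD(2)[OF B]] this]
    show ?thesis by auto
  qed
  have prod_B: "- (x F * x G) \<in> B" if "G \<in> ?S" for G
    using that less.prems by (intro subring_ofD(3,5)[OF B] xB) auto
  have rest: "(\<Sum>G\<in>?S - {F}. - (x F * x G)) \<in> B \<and> (\<exists>k. (\<Sum>G\<in>?S - {F}. - (x F * x G)) ^ k \<in> A)"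
    using fin_S prod_B prod_rad by (intro ideal_of_sum_in_radical[OF B A]) auto
  then obtain j where j: "(\<Sum>G\<in>?S - {F}. - (x F * x G)) ^ j \<in> A" by blast
  obtain k where "?f ^ k \<in> A" using sums[OF less.prems] by blast
  from ideal_of_mult_in_radical[OF B A xB[OF less.prems] this]
  have k: "(x F * ?f) ^ k \<in> A" .
  have sum_B: "sum x T \<in> B" if "T \<subseteq> \<G>" for T
    using that xB subring_ofD(1,4)[OF B]
    by (induction T rule: infinite_finite_induct) auto
  have "x F * ?f \<in> B" using sum_B[of ?S] xB[OF less.prems] subring_ofD(5)[OF B] by auto
  from ideal_of_add_in_radical[OF B A this conjunct1[OF rest] k j]
  have "(x F * ?f + (\<Sum>G\<in>?S - {F}. - (x F * x G))) ^ (k + j) \<in> A" .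
  \<comment> \<open>all mixed products cancel and only the square of \<open>x F\<close> is left\<close>
  moreover have "x F * ?f + (\<Sum>G\<in>?S - {F}. - (x F * x G)) = x F ^ 2"
    using fin_S less.prems
    by (subst sum.remove[of ?S F])
      (auto simp: sum_negf sum_distrib_left distrib_left power2_eq_square)
  ultimately have "x F ^ (2 * (k + j)) \<in> A" by (simp only: power_mult)
  then show ?case ..
qed

section \<open>Ranking the faces outside the subcomplex\<close>

text \<open>The hypotheses of the lemma of Schmitt and Vogel for the square-free monomials of \<open>\<G>\<close> in
  \<open>k[\<Delta>]\<close>: each \<open>x\<^sup>F\<close> with \<open>F \<in> \<Delta> - \<Sigma>\<close> is a multiple of one of them, and the product of two of the
  same rank is zero or a multiple of one of higher rank.\<close>

definition ranked_cover ::
    "nat set set \<Rightarrow> nat set set \<Rightarrow> nat \<Rightarrow> nat set set \<Rightarrow> (nat set \<Rightarrow> nat) \<Rightarrow> bool" where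
  "ranked_cover \<Delta> \<Sigma> m \<G> \<rho> \<longleftrightarrow>
     \<G> \<subseteq> \<Delta> - \<Sigma> \<and> (\<forall>F\<in>\<G>. 1 \<le> \<rho> F \<and> \<rho> F \<le> m) \<and>
     (\<forall>F\<in>\<Delta> - \<Sigma>. \<exists>G\<in>\<G>. G \<subseteq> F) \<and>
     (\<forall>F\<in>\<G>. \<forall>F'\<in>\<G>. F \<noteq> F' \<longrightarrow> \<rho> F = \<rho> F' \<longrightarrow> F \<union> F' \<in> \<Delta> \<longrightarrow>
       (\<exists>G\<in>\<G>. G \<subseteq> F \<union> F' \<and> \<rho> F < \<rho> G))"

text \<open>Rank a face by its size, and by one less if it meets the vertex set \<open>V\<close> of \<open>\<Sigma>\<close>. A union of two
  distinct faces of equal rank with fewer than \<open>d\<close> vertices then has higher rank, except for the pairs \<open>F\<close> and \<open>F \<union> {v}\<close> with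
  \<open>v \<in> V\<close> and \<open>F\<close> disjoint from \<open>V\<close>. These pairs disappear when the redundant faces
  \<open>F \<union> {v}\<close> are removed, and a union that was removed can be replaced by its face \<open>F\<close>, which has
  the same rank.

  The ranks lie between \<open>1\<close> and \<open>d - 2\<close>. At the lower end, a singleton \<open>{v}\<close> with \<open>v \<in> V\<close> is a face
  of \<open>\<Sigma>\<close>. At the upper end, a face with \<open>d - 1\<close> vertices meets \<open>V\<close>: it is a facet, or it lies in a
  face with \<open>d\<close> vertices and so belongs to \<open>\<Sigma>\<close>. A face \<open>F \<in> \<Delta> - \<Sigma>\<close> with \<open>d\<close> vertices has all its
  proper faces in \<open>\<Sigma>\<close>, therefore no other face in \<open>\<Delta> - \<Sigma>\<close> has a common upper bound with \<open>F\<close> in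
  \<open>\<Delta>\<close>, and its rank may be truncated to \<open>d - 2\<close>.\<close>

lemma exists_ranked_cover:
  fixes n d :: nat and \<Sigma> \<Delta> :: "nat set set"
  assumes \<Sigma>: "simplicial_complex n \<Sigma>" and \<Delta>: "simplicial_complex n \<Delta>"
    and d: "3 \<le> d" and dim: "\<And>F. F \<in> \<Delta> \<Longrightarrow> card F \<le> d"
    and ridges: "\<And>F G. F \<in> faces \<Delta> (int d - 1) \<Longrightarrow> G \<in> faces \<Delta> (int d - 2) \<Longrightarrow> G \<subseteq> F \<Longrightarrow>
           G \<in> faces \<Sigma> (int d - 2)"
    and facets: "\<And>F. F \<in> facets \<Delta> (int d - 2) \<Longrightarrow> \<exists>v\<in>F. v \<in> vertices \<Sigma>"
  shows "\<exists>\<G> \<rho>. ranked_cover \<Delta> \<Sigma> (d - 2) \<G> \<rho>"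
proof (cases "{} \<in> \<Sigma>")
  \<comment> \<open>\<open>\<Sigma>\<close> is void, and the monomial of the empty face is \<open>1\<close>\<close>
  case False
  then have "\<Sigma> = {}" using \<Sigma> unfolding simplicial_complex_def by blast
  then show ?thesis
    using \<Delta> d unfolding ranked_cover_def simplicial_complex_def
    by (intro exI[of _ "\<Delta> \<inter> {{}}"] exI[of _ "\<lambda>_. 1"]) auto
next
  case True
  define V where "V = vertices \<Sigma>"
  have down: "G \<in> \<Delta>" if "F \<in> \<Delta>" "G \<subseteq> F" for F G
    using that \<Delta> unfolding simplicial_complex_def by blast
  have down\<Sigma>: "G \<in> \<Sigma>" if "F \<in> \<Sigma>" "G \<subseteq> F" for F G
    using that \<Sigma> unfolding simplicial_complex_def by blast
  have fin: "finite F" if "F \<in> \<Delta>" for F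
    using that \<Delta> unfolding simplicial_complex_def by (auto intro: finite_subset)
  have V_iff: "v \<in> V \<longleftrightarrow> {v} \<in> \<Sigma>" for v by (simp add: V_def vertices_def)
  have proper: "G \<in> \<Sigma>" if F: "F \<in> \<Delta>" "card F = d" and G: "G \<subset> F" for F G
  proof -
    obtain v where v: "v \<in> F" "v \<notin> G" using G by blast
    have "F \<in> faces \<Delta> (int d - 1)" using F by (simp add: faces_def)
    moreover have "F - {v} \<in> faces \<Delta> (int d - 2)"
      using F v d fin[OF F(1)] down[OF F(1), of "F - {v}"] by (auto simp: faces_def)
    ultimately have "F - {v} \<in> \<Sigma>" using ridges[of F "F - {v}"] by (auto simp: faces_def)
    then show ?thesis using down\<Sigma> G v by blast
  qed
  have meets: "F \<inter> V \<noteq> {}" if F: "F \<in> \<Delta>" "card F = d - 1" for F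
  proof (cases "F \<in> \<Sigma>")
    case True
    have "F \<noteq> {}" using F(2) d by auto
    then show ?thesis using down\<Sigma>[OF True] V_iff by blast
  next
    case False
    have "G = F" if G: "G \<in> \<Delta>" "F \<subseteq> G" for G
    proof (rule ccontr)
      assume "G \<noteq> F"
      then have "F \<subset> G" using G by blast
      then have "card F < card G" using fin[OF G(1)] by (rule psubset_card_mono[rotated])
      then have "card G = d" using dim[OF G(1)] F(2) by linarith
      then show False using proper[OF G(1) _ \<open>F \<subset> G\<close>] False by simp
    qed
    then have "F \<in> facets \<Delta> (int d - 2)"
      using F d by (auto simp: facets_def faces_def)
    then show ?thesis using facets by (auto simp: V_def)
  qed
  define r where "r F = (if F \<inter> V = {} then card F else card F - 1)" for F
  define \<rho> where "\<rho> F = min (d - 2) (r F)" for F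
  define \<G> where "\<G> = {F \<in> \<Delta> - \<Sigma>. \<forall>v. F \<inter> V = {v} \<longrightarrow> F - {v} \<in> \<Sigma>}"
  have r_le: "r F \<le> d - 2" if "F \<in> \<Delta>" "card F \<noteq> d" for F
  proof (cases "F \<inter> V = {}")
    case True
    then have "card F \<noteq> d - 1" using meets[OF that(1)] by blast
    then have "card F \<le> d - 2" using dim[OF that(1)] that(2) by linarith
    then show ?thesis by (simp add: r_def True)
  next
    case False
    have "card F \<le> d - 1" using dim[OF that(1)] that(2) by linarith
    then show ?thesis by (simp add: r_def False)
  qed
  have drop: "F - {v} \<in> \<G> \<and> r (F - {v}) = r F" if F: "F \<in> \<Delta> - \<Sigma>" "F \<notin> \<G>" "F \<inter> V = {v}" for F v
  proof -
    from F(1) have "F \<in> \<Delta>" by simp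
    then have "F - {v} \<in> \<Delta>" by (rule down) blast
    moreover have "F - {v} \<notin> \<Sigma>"
    proof
      assume "F - {v} \<in> \<Sigma>"
      then have "F \<in> \<G>" using F(1) by (simp add: \<G>_def F(3))
      then show False using F(2) by simp
    qed
    moreover have "(F - {v}) \<inter> V = F \<inter> V - {v}" by blast
    then have "(F - {v}) \<inter> V = {}" by (simp add: F(3))
    moreover have "v \<in> F \<inter> V" by (simp add: F(3))
    then have "card (F - {v}) = card F - 1" using fin[of F] F(1) by simp
    ultimately show ?thesis
      by (simp add: \<G>_def r_def F(3))
  qed
  have shrink: "\<exists>G\<in>\<G>. G \<subseteq> F \<and> r G = r F" if F: "F \<in> \<Delta> - \<Sigma>" for F
  proof (cases "F \<in> \<G>")
    case False
    then obtain v where "F \<inter> V = {v}" using F by (auto simp: \<G>_def)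
    then show ?thesis using drop[OF F False] by blast
  qed auto
  have "1 \<le> \<rho> F" if F: "F \<in> \<G>" for F
  proof -
    have F': "F \<in> \<Delta>" "F \<notin> \<Sigma>" "finite F" using F fin by (auto simp: \<G>_def)
    have "card F \<noteq> 0" using F' \<open>{} \<in> \<Sigma>\<close> by auto
    moreover have "F \<inter> V = {}" if "card F = 1"
      using that F' V_iff by (auto simp: card_1_singleton_iff)
    ultimately have "1 \<le> r F"
      by (cases "F \<inter> V = {}"; cases "card F = 1") (simp_all add: r_def)
    then show ?thesis using d by (simp add: \<rho>_def)
  qed
  moreover have "\<exists>G\<in>\<G>. G \<subseteq> F \<union> F' \<and> \<rho> F < \<rho> G"
    if F: "F \<in> \<G>" and F': "F' \<in> \<G>" and ne: "F \<noteq> F'" and eq: "\<rho> F = \<rho> F'"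
      and W: "F \<union> F' \<in> \<Delta>" for F F'
  proof -
    let ?W = "F \<union> F'"
    have F0: "F \<in> \<Delta> - \<Sigma>" "F' \<in> \<Delta> - \<Sigma>" using F F' by (auto simp: \<G>_def)
    have W\<Sigma>: "?W \<notin> \<Sigma>" using F0 down\<Sigma>[of ?W F] by blast
    have cardW: "card ?W \<noteq> d"
    proof
      assume "card ?W = d"
      then have "F = ?W" "F' = ?W" using proper[OF W] F0 by blast+
      then show False using ne by simp
    qed
    have small: "card G \<noteq> d" if "G \<subseteq> ?W" for G
      using that cardW dim[OF W] card_mono[OF fin[OF W] that] by linarith
    have \<rho>_r: "\<rho> G = r G" if "G \<subseteq> ?W" for G
      using r_le[OF down[OF W that] small[OF that]] by (simp add: \<rho>_def)
    have eq_r: "r F = r F'" using eq \<rho>_r[of F] \<rho>_r[of F'] by simp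
    have finW: "finite ?W" "finite F" "finite F'" using fin[OF W] by auto
    \<comment> \<open>the hypothesis \<open>disj\<close> fixes the order of the two faces: only \<open>G\<close> may meet \<open>V\<close> alone\<close>
    have less_aux: "r G < r (G \<union> H)"
      if GH: "G \<in> \<G>" "H \<in> \<G>" "G \<noteq> H" "r G = r H" "G \<union> H = ?W" and disj: "G \<inter> V = {} \<Longrightarrow> H \<inter> V = {}" for G H
    proof -
      have fin': "finite G" "finite H" using GH(1,2) fin by (auto simp: \<G>_def)
      have nonempty: "card G \<noteq> 0" if "G \<inter> V \<noteq> {}" using fin' that by auto
      have nonempty': "card H \<noteq> 0" if "H \<inter> V \<noteq> {}" using fin' that by auto
      show ?thesis
      proof (cases "G \<subset> G \<union> H")
        case True
        then have less: "card G < card (G \<union> H)" using fin' by (intro psubset_card_mono) auto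
        show ?thesis
        proof (cases "G \<inter> V = {}")
          case True
          then have "(G \<union> H) \<inter> V = {}" using disj by blast
          then show ?thesis using less True by (simp add: r_def)
        next
          case False
          then have "(G \<union> H) \<inter> V \<noteq> {}" by blast
          then show ?thesis using less False nonempty by (simp add: r_def)
        qed
      next
        case False
        then have HG: "H \<subset> G" using GH(3) by blast
        then have less: "card H < card G" using fin' by (intro psubset_card_mono) auto
        have "H \<inter> V = {}"
        proof (rule ccontr)
          assume HV: "H \<inter> V \<noteq> {}"
          then have "G \<inter> V \<noteq> {}" using HG by blast
          then show False using HV nonempty'[OF HV] less GH(4) by (simp add: r_def)
        qed
        moreover from this have GV: "G \<inter> V \<noteq> {}" using less GH(4) by (auto simp: r_def)
        ultimately have HV: "H \<inter> V = {}" and card: "card G = Suc (card H)"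
          using GH(4) less by (simp_all add: r_def)
        obtain v where v: "v \<in> G" "v \<in> V" using GV by blast
        have "H \<subseteq> G - {v}" using HG HV v by blast
        moreover have "card (G - {v}) = card H" using card v fin' by simp
        ultimately have H: "H = G - {v}" using fin' by (intro card_subset_eq) auto
        have "G \<inter> V = insert v (H \<inter> V)" using H v by blast
        then have "G \<inter> V = {v}" using HV by simp
        then have "H \<in> \<Sigma>" using GH(1) H by (simp add: \<G>_def)
        then show ?thesis using GH(2) by (auto simp: \<G>_def)
      qed
    qed
    have "r F < r ?W"
    proof (cases "F \<inter> V = {} \<longrightarrow> F' \<inter> V = {}")
      case True
      then show ?thesis using less_aux[OF F F' ne eq_r] by simp
    next
      case False
      then show ?thesis using less_aux[OF F' F] ne eq_r by (simp add: Un_commute)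
    qed
    moreover obtain G where G: "G \<in> \<G>" "G \<subseteq> ?W" "r G = r ?W" using shrink[of ?W] W W\<Sigma> by auto
    ultimately have "\<rho> F < \<rho> G" using \<rho>_r[of F] \<rho>_r[of G] by simp
    then show ?thesis using G by blast
  qed
  moreover have "\<G> \<subseteq> \<Delta> - \<Sigma>" by (auto simp: \<G>_def)
  moreover have "\<rho> F \<le> d - 2" for F by (simp add: \<rho>_def)
  moreover have "\<exists>G\<in>\<G>. G \<subseteq> F" if "F \<in> \<Delta> - \<Sigma>" for F using shrink[OF that] by blast
  ultimately show ?thesis unfolding ranked_cover_def
    by (intro exI[of _ \<G>] exI[of _ \<rho>] conjI ballI impI) simp_all
qed

section \<open>Faces and prime ideals of Stanley-Reisner rings\<close>

lemma (in ring) quotient_image_iff: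
  assumes Q: "ideal Q R" and P: "ideal P R" and sub: "Q \<subseteq> P" and a: "a \<in> carrier R"
  shows "Q +> a \<in> (+>) Q ` P \<longleftrightarrow> a \<in> P"
proof -
  have "(+>) Q ` P \<subseteq> carrier (R Quot Q)"
    using additive_subgroup.a_subset[OF ideal.axioms(1)[OF ring_ideal_imp_quot_ideal[OF Q P]]] .
  moreover have "\<Union> ((+>) Q ` P) = P" by (rule sym, rule iffD1[OF ideal_incl_iff[OF Q P] sub])
  ultimately show ?thesis using canonical_proj_vimage_mem_iff[OF Q _ a, of "(+>) Q ` P"] by simp
qed

lemma primeideal_quotient_image:
  fixes S :: "('a, 'b) ring_scheme"
  assumes "cring S" and Q: "ideal Q S" and P: "primeideal P S" and sub: "Q \<subseteq> P"
  shows "primeideal ((+>\<^bsub>S\<^esub>) Q ` P) (S Quot Q)"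
proof -
  interpret cring S by fact
  interpret P: primeideal P S by fact
  interpret hom: ring_hom_ring S "S Quot Q" "(+>\<^bsub>S\<^esub>) Q" by (rule ideal.rcos_ring_hom_ring[OF Q])
  have carrier: "carrier (S Quot Q) = (+>\<^bsub>S\<^esub>) Q ` carrier S"
    unfolding FactRing_def A_RCOSETS_def'[of S Q] by auto
  note mem = quotient_image_iff[OF Q P.is_ideal sub]
  show ?thesis
  proof (rule primeidealI)
    show "ideal ((+>\<^bsub>S\<^esub>) Q ` P) (S Quot Q)" by (rule ring_ideal_imp_quot_ideal[OF Q P.is_ideal])
    show "cring (S Quot Q)" by (rule ideal.quotient_is_cring[OF Q is_cring])
    obtain a where "a \<in> carrier S" "a \<notin> P" using P.I_notcarr P.Icarr by blast
    then have "Q +>\<^bsub>S\<^esub> a \<notin> (+>\<^bsub>S\<^esub>) Q ` P" "Q +>\<^bsub>S\<^esub> a \<in> carrier (S Quot Q)"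
      by (simp_all add: mem carrier)
    then show "carrier (S Quot Q) \<noteq> (+>\<^bsub>S\<^esub>) Q ` P" by metis
  next
    fix x y assume "x \<in> carrier (S Quot Q)" "y \<in> carrier (S Quot Q)"
      and xy: "x \<otimes>\<^bsub>S Quot Q\<^esub> y \<in> (+>\<^bsub>S\<^esub>) Q ` P"
    then obtain a b where ab: "a \<in> carrier S" "b \<in> carrier S" "x = Q +>\<^bsub>S\<^esub> a" "y = Q +>\<^bsub>S\<^esub> b"
      unfolding carrier by blast
    then have "Q +>\<^bsub>S\<^esub> (a \<otimes>\<^bsub>S\<^esub> b) \<in> (+>\<^bsub>S\<^esub>) Q ` P" using xy by simp
    then have "a \<otimes>\<^bsub>S\<^esub> b \<in> P" using mem[of "a \<otimes>\<^bsub>S\<^esub> b"] ab by simp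
    then have "a \<in> P \<or> b \<in> P" using P.I_prime ab(1,2) by simp
    then show "x \<in> (+>\<^bsub>S\<^esub>) Q ` P \<or> y \<in> (+>\<^bsub>S\<^esub>) Q ` P" by (auto simp: ab(3,4))
  qed
qed

definition monom_of :: "nat set \<Rightarrow> nat \<Rightarrow>\<^sub>0 nat" where
  "monom_of F = (\<Sum>i\<in>F. Poly_Mapping.single i 1)"

lemma keys_monom_of: "finite F \<Longrightarrow> Poly_Mapping.keys (monom_of F) = F"
  by (induction F rule: finite_induct) (auto simp: monom_of_def keys_monom_add)

lemma sqfree_monom_eq_single:
  assumes "finite F"
  shows "sqfree_monom F = (Poly_Mapping.single (monom_of F) 1 :: 'k::field mpoly)"
  using assms
  by (induction F) (simp_all add: sqfree_monom_def monom_of_def mpoly_var_def mult_single)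

lemma sqfree_monom_in_polys_in:
  assumes "F \<subseteq> {1..n}"
  shows "sqfree_monom F \<in> carrier (poly_ring n)"
proof -
  have "finite F" using assms by (rule finite_subset) simp
  then show ?thesis
    using assms by (simp add: carrier_poly_ring polys_in_def sqfree_monom_eq_single keys_monom_of)
qed

text \<open>The prime ideal generated by the variables with index outside \<open>G\<close>.\<close>

definition coordinate_prime :: "nat \<Rightarrow> nat set \<Rightarrow> 'k::field mpoly set" where
  "coordinate_prime n G =
     {p \<in> carrier (poly_ring n). \<forall>m \<in> Poly_Mapping.keys p. \<not> Poly_Mapping.keys m \<subseteq> G}"

lemma ideal_coordinate_prime: "ideal (coordinate_prime n G) (poly_ring n :: 'k::field mpoly ring)"
proof -
  interpret P: cring "poly_ring n :: 'k mpoly ring" by (rule cring_poly_ring)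
  have mult: "r * p \<in> coordinate_prime n G"
    if p: "p \<in> coordinate_prime n G" and r: "r \<in> carrier (poly_ring n)" for p r :: "'k mpoly"
  proof -
    have "\<not> Poly_Mapping.keys m \<subseteq> G" if m: "m \<in> Poly_Mapping.keys (r * p)" for m
    proof -
      obtain a b where "m = a + b" "b \<in> Poly_Mapping.keys p"
        using keys_mult[of r p] m by blast
      then show ?thesis using p by (auto simp: coordinate_prime_def keys_monom_add)
    qed
    then show ?thesis using P.m_closed[OF r, of p] p by (simp add: coordinate_prime_def)
  qed
  have minus: "\<ominus>\<^bsub>poly_ring n\<^esub> p = - p" if "p \<in> carrier (poly_ring n)" for p :: "'k mpoly"
    using P.minus_equality[of "- p" p] that polys_in_uminus[of p] by (simp add: carrier_poly_ring)
  show ?thesis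
  proof (intro idealI P.ring_axioms P.add.subgroupI)
    have "(0 :: 'k mpoly) \<in> coordinate_prime n G" using P.zero_closed by (simp add: coordinate_prime_def)
    then show "coordinate_prime n G \<noteq> ({} :: 'k mpoly set)" by (metis empty_iff)
  next
    fix p q :: "'k mpoly" assume pq: "p \<in> coordinate_prime n G" "q \<in> coordinate_prime n G"
    have "\<not> Poly_Mapping.keys m \<subseteq> G" if "m \<in> Poly_Mapping.keys (p + q)" for m
      using subsetD[OF Poly_Mapping.keys_add that] pq unfolding coordinate_prime_def by blast
    then show "p \<oplus>\<^bsub>poly_ring n\<^esub> q \<in> coordinate_prime n G"
      using P.a_closed[of p q] pq by (simp add: coordinate_prime_def)
    have "- p \<in> coordinate_prime n G"
      using pq(1) by (simp add: coordinate_prime_def carrier_poly_ring polys_in_uminus)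
    then show "\<ominus>\<^bsub>poly_ring n\<^esub> p \<in> coordinate_prime n G"
      using minus[of p] pq(1) by (simp add: coordinate_prime_def)
  next
    fix p r :: "'k mpoly" assume "p \<in> coordinate_prime n G" "r \<in> carrier (poly_ring n)"
    from mult[OF this] show "r \<otimes>\<^bsub>poly_ring n\<^esub> p \<in> coordinate_prime n G"
      "p \<otimes>\<^bsub>poly_ring n\<^esub> r \<in> coordinate_prime n G" by (simp_all add: mult.commute)
  qed (simp add: coordinate_prime_def subset_iff)
qed

text \<open>Modulo this ideal a polynomial equals its part \<open>lo\<close> that involves only the variables of \<open>G\<close>, and
  the product of two non-zero parts is a non-zero polynomial in these variables.\<close>

lemma primeideal_coordinate_prime:
  "primeideal (coordinate_prime n G) (poly_ring n :: 'k::field mpoly ring)"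
proof (rule primeidealI[OF ideal_coordinate_prime cring_poly_ring])
  let ?P = "coordinate_prime n G :: 'k mpoly set"
  have "1 \<notin> ?P" by (simp add: coordinate_prime_def)
  moreover have "1 \<in> carrier (poly_ring n)" by (simp add: carrier_poly_ring polys_in_1)
  ultimately show "carrier (poly_ring n) \<noteq> ?P" by metis
  have ideal: "ideal_of (carrier (poly_ring n)) ?P"
    by (rule ideal_poly_ring_imp_ideal_of[OF ideal_coordinate_prime])
  fix a b :: "'k mpoly"
  assume a: "a \<in> carrier (poly_ring n)" and b: "b \<in> carrier (poly_ring n)"
    and "a \<otimes>\<^bsub>poly_ring n\<^esub> b \<in> ?P"
  then have ab: "a * b \<in> ?P" by simp
  define lo where "lo p = (\<Sum>m \<in> {m \<in> Poly_Mapping.keys p. Poly_Mapping.keys m \<subseteq> G}.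
      Poly_Mapping.single m (Poly_Mapping.lookup p m))" for p :: "'k mpoly"
  have lookup_lo: "Poly_Mapping.lookup (lo p) m =
      (if Poly_Mapping.keys m \<subseteq> G then Poly_Mapping.lookup p m else 0)" for p m
    by (auto simp: lo_def lookup_sum lookup_single when_def in_keys_iff)
  have keys_lo: "m \<in> Poly_Mapping.keys (lo p) \<longleftrightarrow> m \<in> Poly_Mapping.keys p \<and> Poly_Mapping.keys m \<subseteq> G" for p m
    by (auto simp: in_keys_iff lookup_lo)
  have lo_closed: "lo p \<in> carrier (poly_ring n)" if "p \<in> carrier (poly_ring n)" for p
    using that by (auto simp: carrier_poly_ring polys_in_def keys_lo)
  have hi: "p + - lo p \<in> ?P" if p: "p \<in> carrier (poly_ring n)" for p
  proof -
    have "\<not> Poly_Mapping.keys m \<subseteq> G" if "m \<in> Poly_Mapping.keys (p + - lo p)" for m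
      using that by (auto simp: in_keys_iff lookup_minus lookup_lo)
    moreover have "p + - lo p \<in> carrier (poly_ring n)"
      using p lo_closed[OF p] by (simp add: carrier_poly_ring polys_in_add polys_in_uminus del: add_uminus_conv_diff)
    ultimately show ?thesis unfolding coordinate_prime_def by blast
  qed
  show "a \<in> ?P \<or> b \<in> ?P"
  proof (rule ccontr)
    assume "\<not> (a \<in> ?P \<or> b \<in> ?P)"
    then obtain u v where "u \<in> Poly_Mapping.keys a" "Poly_Mapping.keys u \<subseteq> G"
        "v \<in> Poly_Mapping.keys b" "Poly_Mapping.keys v \<subseteq> G"
      using a b unfolding coordinate_prime_def by blast
    then have "u \<in> Poly_Mapping.keys (lo a)" "v \<in> Poly_Mapping.keys (lo b)" by (simp_all add: keys_lo)
    then have "lo a \<noteq> 0" "lo b \<noteq> 0" by auto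
    then have "lo a * lo b \<noteq> 0" by simp
    then obtain m where m: "m \<in> Poly_Mapping.keys (lo a * lo b)" by fastforce
    then obtain s t where "m = s + t" "s \<in> Poly_Mapping.keys (lo a)" "t \<in> Poly_Mapping.keys (lo b)"
      using keys_mult[of "lo a" "lo b"] by blast
    then have "Poly_Mapping.keys m \<subseteq> G" by (simp add: keys_lo keys_monom_add)
    then have "lo a * lo b \<notin> ?P" using m by (auto simp: coordinate_prime_def)
    moreover have "lo a * lo b \<in> ?P"
    proof -
      have minus: "- p \<in> carrier (poly_ring n)" if "p \<in> carrier (poly_ring n)" for p :: "'k mpoly"
        using that by (simp add: carrier_poly_ring polys_in_uminus)
      have "- lo b * (a + - lo a) + - a * (b + - lo b) + a * b \<in> ?P"
        by (intro ideal_ofD(3,4)[OF ideal] hi a b ab minus lo_closed)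
      moreover have "- lo b * (a + - lo a) + - a * (b + - lo b) + a * b = lo a * lo b"
        by (simp add: algebra_simps)
      ultimately show ?thesis by simp
    qed
    ultimately show False by blast
  qed
qed

lemma ideal_SR_ideal: "ideal (SR_ideal n \<Delta>) (poly_ring n)"
  unfolding SR_ideal_def
  by (intro ring.genideal_ideal cring.axioms(1) cring_poly_ring image_subsetI
      sqfree_monom_in_polys_in) blast

lemma SR_ideal_minimal:
  assumes "ideal K (poly_ring n)" "\<And>F. F \<subseteq> {1..n} \<Longrightarrow> F \<notin> \<Delta> \<Longrightarrow> sqfree_monom F \<in> K"
  shows "SR_ideal n \<Delta> \<subseteq> (K :: 'k::field mpoly set)"
  unfolding SR_ideal_def
  using assms by (intro ring.genideal_minimal cring.axioms(1) cring_poly_ring) auto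

lemma sqfree_monom_in_SR_ideal:
  assumes "F \<subseteq> {1..n}" "F \<notin> \<Delta>"
  shows "sqfree_monom F \<in> SR_ideal n \<Delta>"
proof -
  have "sqfree_monom ` (Pow {1..n} - \<Delta>) \<subseteq> SR_ideal n \<Delta>"
    unfolding SR_ideal_def
    by (intro ring.genideal_self cring.axioms(1) cring_poly_ring image_subsetI
        sqfree_monom_in_polys_in) blast
  then show ?thesis using assms by blast
qed

text \<open>Removing the elements of a face one at a time gives a strictly ascending chain of coordinate
  primes, all of which contain the Stanley-Reisner ideal.\<close>

lemma card_face_le_krull_dim:
  assumes \<Delta>: "simplicial_complex n \<Delta>" and F: "F \<in> \<Delta>"
  shows "ereal (real (card F)) \<le> krull_dim (SR_ring n \<Delta> :: 'k::field mpoly set ring)"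
proof -
  let ?S = "poly_ring n :: 'k mpoly ring"
  let ?Q = "SR_ideal n \<Delta> :: 'k mpoly set"
  interpret S: cring ?S by (rule cring_poly_ring)
  have Fn: "F \<subseteq> {1..n}" using \<Delta> F unfolding simplicial_complex_def by blast
  then have finF: "finite F" by (rule finite_subset) simp
  obtain h where h: "bij_betw h {0..<card F} F" using ex_bij_betw_nat_finite[OF finF] ..
  define G where "G i = h ` {i..<card F}" for i
  have GF: "G i \<subseteq> F" for i using bij_betw_imp_surj_on[OF h] unfolding G_def by auto
  define P where "P i = (coordinate_prime n (G i) :: 'k mpoly set)" for i
  have QP: "?Q \<subseteq> P i" for i
    unfolding P_def
  proof (rule SR_ideal_minimal[OF ideal_coordinate_prime])
    fix N assume N: "N \<subseteq> {1..n}" "N \<notin> \<Delta>"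
    have "\<not> N \<subseteq> G i"
    proof
      assume "N \<subseteq> G i"
      then have "N \<subseteq> F" using GF by (rule subset_trans)
      then have "N \<in> \<Delta>" using \<Delta> F by (simp add: simplicial_complex_def)
      then show False using N(2) by simp
    qed
    moreover have "finite N" using N(1) by (rule finite_subset) simp
    ultimately have "\<forall>m\<in>Poly_Mapping.keys (sqfree_monom N :: 'k mpoly). \<not> Poly_Mapping.keys m \<subseteq> G i"
      by (simp add: sqfree_monom_eq_single keys_monom_of)
    then show "sqfree_monom N \<in> (coordinate_prime n (G i) :: 'k mpoly set)"
      using sqfree_monom_in_polys_in[OF N(1)] unfolding coordinate_prime_def by blast
  qed
  have prime: "primeideal ((+>\<^bsub>?S\<^esub>) ?Q ` P i) (SR_ring n \<Delta>)" for i
    unfolding SR_ring_def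
    by (rule primeideal_quotient_image[OF cring_poly_ring ideal_SR_ideal _ QP])
      (simp add: P_def primeideal_coordinate_prime)
  have strict: "(+>\<^bsub>?S\<^esub>) ?Q ` P i \<subset> (+>\<^bsub>?S\<^esub>) ?Q ` P (Suc i)" if i: "i < card F" for i
  proof -
    have "G (Suc i) \<subseteq> G i" unfolding G_def by auto
    then have le: "P i \<subseteq> P (Suc i)" unfolding P_def coordinate_prime_def by auto
    have "h i \<in> G i" using i unfolding G_def by auto
    have "h i \<notin> G (Suc i)"
    proof
      assume "h i \<in> G (Suc i)"
      then obtain j where "Suc i \<le> j" "j < card F" "h i = h j" unfolding G_def by auto
      then show False using bij_betw_imp_inj_on[OF h] i unfolding inj_on_def by force
    qed
    have "h i \<in> {1..n}" using \<open>h i \<in> G i\<close> GF[of i] Fn by blast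
    then have x: "mpoly_var (h i) \<in> carrier ?S"
      by (auto simp: mpoly_var_def carrier_poly_ring polys_in_def)
    have "mpoly_var (h i) \<in> P (Suc i)" "mpoly_var (h i) \<notin> P i"
      using x \<open>h i \<in> G i\<close> \<open>h i \<notin> G (Suc i)\<close>
      by (auto simp: P_def coordinate_prime_def mpoly_var_def)
    then have "?Q +>\<^bsub>?S\<^esub> mpoly_var (h i) \<notin> (+>\<^bsub>?S\<^esub>) ?Q ` P i"
      using S.quotient_image_iff[OF ideal_SR_ideal ideal_coordinate_prime, of \<Delta> "G i"] QP[of i] x
      by (simp add: P_def)
    then show ?thesis using le \<open>mpoly_var (h i) \<in> P (Suc i)\<close> by blast
  qed
  show ?thesis
    unfolding krull_dim_def
    by (intro Sup_upper CollectI exI[of _ "card F"] exI[of _ "\<lambda>i. (+>\<^bsub>?S\<^esub>) ?Q ` P i"] conjI allI impI refl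
        prime strict)
qed

section \<open>Generators up to radical\<close>

lemma acc_SR_ring: "acc_on (\<lambda>K. ideal K (SR_ring n \<Delta> :: 'k::field mpoly set ring))"
  unfolding SR_ring_def by (rule acc_quotient[OF cring_poly_ring ideal_SR_ideal acc_poly_ring])

abbreviation SR_class :: "nat \<Rightarrow> nat set set \<Rightarrow> 'k::field mpoly \<Rightarrow> 'k mpoly set" where
  "SR_class n \<Delta> p \<equiv> SR_ideal n \<Delta> +>\<^bsub>poly_ring n\<^esub> p"

lemma ring_hom_SR_class: "ring_hom_ring (poly_ring n) (SR_ring n \<Delta>) (SR_class n \<Delta>)"
  unfolding SR_ring_def by (rule ideal.rcos_ring_hom_ring[OF ideal_SR_ideal])

lemma SR_class_power:
  fixes p :: "'k::field mpoly"
  assumes p: "p \<in> carrier (poly_ring n)"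
  shows "SR_class n \<Delta> p [^]\<^bsub>SR_ring n \<Delta>\<^esub> (k::nat) = SR_class n \<Delta> (p ^ k)"
proof -
  interpret hom: ring_hom_ring "poly_ring n" "SR_ring n \<Delta>" "SR_class n \<Delta> :: 'k mpoly \<Rightarrow> _"
    by (rule ring_hom_SR_class)
  have closed: "p ^ k \<in> carrier (poly_ring n)" for k
    using p by (induction k) (simp_all add: carrier_poly_ring polys_in_1 polys_in_mult)
  show ?thesis
  proof (induction k)
    case 0
    show ?case using hom.hom_one by simp
  next
    case (Suc k)
    show ?case using hom.hom_mult[OF closed[of k] p] Suc by (simp add: mult.commute)
  qed
qed

lemma SR_class_zero:
  assumes "p \<in> SR_ideal n \<Delta>"
  shows "SR_class n \<Delta> p = \<zero>\<^bsub>SR_ring n \<Delta>\<^esub>"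
  using ring.a_rcos_zero[OF cring.axioms(1)[OF cring_poly_ring] ideal_SR_ideal assms]
  by (simp add: SR_ring_def FactRing_def)

lemma sqfree_monom_split:
  assumes "finite F" "G \<subseteq> F"
  shows "sqfree_monom F = sqfree_monom (F - G) * (sqfree_monom G :: 'k::field mpoly)"
  unfolding sqfree_monom_def by (rule prod.subset_diff[OF assms(2,1)])

lemma sqfree_monom_mult:
  assumes "finite F" "finite G"
  shows "sqfree_monom F * sqfree_monom G = sqfree_monom (F \<inter> G) * (sqfree_monom (F \<union> G) :: 'k::field mpoly)"
  unfolding sqfree_monom_def using prod.union_inter[OF assms, of "mpoly_var :: nat \<Rightarrow> 'k mpoly"] by (simp add: mult.commute)

text \<open>The elements \<open>f\<^sub>1, \<dots>, f\<^sub>m\<close> of \<open>k[\<Delta>]\<close>, where \<open>f\<^sub>s\<close> is the sum of the monomials of rank \<open>s\<close>.\<close>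

definition rank_sums :: "nat \<Rightarrow> nat set set \<Rightarrow> nat set set \<Rightarrow> (nat set \<Rightarrow> nat) \<Rightarrow> nat \<Rightarrow> 'k::field mpoly set list"
  where "rank_sums n \<Delta> \<G> \<rho> m =
    map (\<lambda>s. SR_class n \<Delta> (\<Sum>F | F \<in> \<G> \<and> \<rho> F = s. sqfree_monom F)) [1..<Suc m]"

text \<open>The ideals \<open>J\<close> and \<open>(f\<^sub>1, \<dots>, f\<^sub>m)\<close> have the same radical. As \<open>f\<^sub>s \<in> J\<close>, only one direction is
  not immediate. For this, the lemma of Schmitt and Vogel is applied to the ideal \<open>A\<close> of the
  polynomials that annihilate \<open>x\<close>.\<close>

lemma torsion_iff_rank_sums_torsion:
  fixes M :: "('k::field mpoly set, 'm) module"
  assumes \<Delta>: "simplicial_complex n \<Delta>"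
    and cover: "ranked_cover \<Delta> \<Sigma> m \<G> \<rho>"
    and M: "module (SR_ring n \<Delta>) M" and x: "x \<in> carrier M"
  shows "set (rank_sums n \<Delta> \<G> \<rho> m) \<subseteq> carrier (SR_ring n \<Delta> :: 'k mpoly set ring)"
    and "ideal_torsion (SR_ring n \<Delta>) M (SR_ideal_image n \<Delta> \<Sigma>) x \<longleftrightarrow>
      power_torsion (SR_ring n \<Delta>) M (rank_sums n \<Delta> \<G> \<rho> m) x"
proof -
  let ?S = "poly_ring n :: 'k mpoly ring" and ?R = "SR_ring n \<Delta> :: 'k mpoly set ring"
  let ?\<pi> = "SR_class n \<Delta> :: 'k mpoly \<Rightarrow> _" and ?J = "SR_ideal_image n \<Delta> \<Sigma> :: 'k mpoly set set"
  let ?x = "sqfree_monom :: nat set \<Rightarrow> 'k mpoly"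
  let ?fs = "rank_sums n \<Delta> \<G> \<rho> m :: 'k mpoly set list"
  let ?f = "\<lambda>s. \<Sum>F | F \<in> \<G> \<and> \<rho> F = s. ?x F"
  have \<G>: "\<G> \<subseteq> \<Delta> - \<Sigma>" and \<rho>: "\<And>F. F \<in> \<G> \<Longrightarrow> 1 \<le> \<rho> F \<and> \<rho> F \<le> m"
    and below: "\<And>F. F \<in> \<Delta> - \<Sigma> \<Longrightarrow> \<exists>G\<in>\<G>. G \<subseteq> F"
    and rise: "\<And>F F'. F \<in> \<G> \<Longrightarrow> F' \<in> \<G> \<Longrightarrow> F \<noteq> F' \<Longrightarrow> \<rho> F = \<rho> F' \<Longrightarrow> F \<union> F' \<in> \<Delta> \<Longrightarrow>
      \<exists>G\<in>\<G>. G \<subseteq> F \<union> F' \<and> \<rho> F < \<rho> G"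
    using cover by (simp_all add: ranked_cover_def)
  interpret S: cring ?S by (rule cring_poly_ring)
  interpret M: module ?R M by (rule M)
  interpret hom: ring_hom_ring ?S ?R ?\<pi> by (rule ring_hom_SR_class)
  have sub_n: "F \<subseteq> {1..n}" if "F \<in> \<G>" for F
    using that \<G> \<Delta> by (auto simp: simplicial_complex_def)
  then have fin\<G>: "finite \<G>" by (intro finite_subset[of \<G> "Pow {1..n}"]) auto
  have fin: "finite F" if "F \<in> \<G>" for F using sub_n[OF that] by (rule finite_subset) simp
  have xS: "?x F \<in> carrier ?S" if "F \<subseteq> {1..n}" for F using that by (rule sqfree_monom_in_polys_in)
  have fJ: "?f s \<in> SR_ideal n \<Sigma>" for s
  proof -
    have "sum ?x T \<in> SR_ideal n \<Sigma>" if "T \<subseteq> \<G>" for T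
      using that
    proof (induction T rule: infinite_finite_induct)
      case (insert F T)
      then have "F \<subseteq> {1..n}" "F \<notin> \<Sigma>" using sub_n \<G> by auto
      from sqfree_monom_in_SR_ideal[OF this] insert show ?case
        using ideal_ofD(3)[OF ideal_poly_ring_imp_ideal_of[OF ideal_SR_ideal]] by auto
    qed (simp_all add: ideal_ofD(2)[OF ideal_poly_ring_imp_ideal_of[OF ideal_SR_ideal]])
    from this[of "{F. F \<in> \<G> \<and> \<rho> F = s}"] show ?thesis by auto
  qed
  have J: "ideal ?J ?R"
    unfolding SR_ideal_image_def SR_ring_def
    by (rule S.ring_ideal_imp_quot_ideal[OF ideal_SR_ideal ideal_SR_ideal])
  have fS: "?f s \<in> carrier ?S" for s using ideal.Icarr[OF ideal_SR_ideal fJ] .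
  show fs: "set ?fs \<subseteq> carrier ?R"
    unfolding rank_sums_def using hom.hom_closed[OF fS] by auto
  show "ideal_torsion ?R M ?J x \<longleftrightarrow> power_torsion ?R M ?fs x"
  proof
    assume "ideal_torsion ?R M ?J x"
    then obtain t :: nat where t: "\<And>r. r \<in> ?J [^]\<^bsub>ideals_set ?R\<^esub> t \<Longrightarrow> r \<odot>\<^bsub>M\<^esub> x = \<zero>\<^bsub>M\<^esub>"
      unfolding ideal_torsion_def by blast
    have J_sub: "?J \<subseteq> carrier ?R" using ideal.Icarr[OF J] by blast
    show "power_torsion ?R M ?fs x"
      unfolding power_torsion_def
    proof
      fix f assume "f \<in> set ?fs"
      then have "f \<in> ?J" unfolding rank_sums_def SR_ideal_image_def using fJ by auto
      from t[OF M.R.pow_in_ideals_set_pow[OF this J_sub]]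
      show "\<exists>k::nat. (f [^]\<^bsub>?R\<^esub> k) \<odot>\<^bsub>M\<^esub> x = \<zero>\<^bsub>M\<^esub>" ..
    qed
  next
    assume pt: "power_torsion ?R M ?fs x"
    define A where "A = {p \<in> carrier ?S. ?\<pi> p \<in> annihilator ?R M x}"
    have "ideal A ?S" unfolding A_def by (rule hom.ideal_vimage[OF ideal_annihilator[OF M x]])
    then have A: "ideal_of (carrier ?S) A" by (rule ideal_poly_ring_imp_ideal_of)
    have B: "subring_of (carrier ?S)" by (simp add: carrier_poly_ring subring_polys_in)
    have A_iff: "p ^ k \<in> A \<longleftrightarrow> ((?\<pi> p) [^]\<^bsub>?R\<^esub> k) \<odot>\<^bsub>M\<^esub> x = \<zero>\<^bsub>M\<^esub>"
      if p: "p \<in> carrier ?S" for p and k :: nat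
    proof -
      have "p ^ k \<in> carrier ?S"
        using p by (induction k) (simp_all add: carrier_poly_ring polys_in_1 polys_in_mult)
      then show ?thesis
        using hom.hom_closed[of "p ^ k"] by (simp add: A_def annihilator_def SR_class_power[OF p])
    qed
    have non_face: "?x F \<in> A" if F: "F \<subseteq> {1..n}" "F \<notin> \<Delta>" for F
    proof -
      have "?\<pi> (?x F) = \<zero>\<^bsub>?R\<^esub>" by (rule SR_class_zero[OF sqfree_monom_in_SR_ideal[OF F]])
      then show ?thesis using xS[OF F(1)] x by (simp add: A_def annihilator_def)
    qed
    have \<G>_rad: "\<exists>k. ?x F ^ k \<in> A" if F: "F \<in> \<G>" for F
    proof (rule schmitt_vogel[OF B A fin\<G> _ _ _ F, where \<rho> = \<rho>])
      fix F assume "F \<in> \<G>"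
      then show "?x F \<in> carrier ?S" by (rule xS[OF sub_n])
    next
      fix F assume "F \<in> \<G>"
      then have "\<rho> F \<in> set [1..<Suc m]" using \<rho> by force
      then have "?\<pi> (?f (\<rho> F)) \<in> set ?fs"
        unfolding rank_sums_def set_map by (rule imageI)
      then show "\<exists>k. ?f (\<rho> F) ^ k \<in> A" using pt A_iff[OF fS] unfolding power_torsion_def by blast
    next
      fix F F' assume F: "F \<in> \<G>" "F' \<in> \<G>" "F \<noteq> F'" "\<rho> F = \<rho> F'"
      have finFF: "finite (F \<union> F')" using fin F by simp
      have FF_n: "F \<inter> F' \<subseteq> {1..n}" "F \<union> F' \<subseteq> {1..n}" using sub_n F by auto
      have mult: "?x F * ?x F' = ?x (F \<inter> F') * ?x (F \<union> F')"
        using sqfree_monom_mult[OF fin[OF F(1)] fin[OF F(2)]] .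
      show "?x F * ?x F' \<in> A \<or> (\<exists>G\<in>\<G>. \<rho> F < \<rho> G \<and> (\<exists>c\<in>carrier ?S. ?x F * ?x F' = c * ?x G))"
      proof (cases "F \<union> F' \<in> \<Delta>")
        case True
        then obtain G where G: "G \<in> \<G>" "G \<subseteq> F \<union> F'" "\<rho> F < \<rho> G" using rise F by blast
        have "?x F * ?x F' = (?x (F \<inter> F') * ?x (F \<union> F' - G)) * ?x G"
          unfolding mult sqfree_monom_split[OF finFF G(2)] by (simp only: mult.assoc)
        moreover have "?x (F \<inter> F') * ?x (F \<union> F' - G) \<in> carrier ?S"
          using FF_n by (intro subring_ofD(5)[OF B] xS) auto
        ultimately show ?thesis using G by blast
      next
        case False
        then show ?thesis
          unfolding mult using ideal_ofD(4)[OF A xS[OF FF_n(1)] non_face[OF FF_n(2)]] by simp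
      qed
    qed
    have rad: "\<exists>k. ?x F ^ k \<in> A" if F: "F \<subseteq> {1..n}" "F \<notin> \<Sigma>" for F
    proof (cases "F \<in> \<Delta>")
      case True
      then obtain G where G: "G \<in> \<G>" "G \<subseteq> F" using below F by blast
      then obtain k where k: "?x G ^ k \<in> A" using \<G>_rad by blast
      have "?x (F - G) \<in> carrier ?S" using F by (intro xS) auto
      then have "(?x (F - G) * ?x G) ^ k \<in> A" by (rule ideal_of_mult_in_radical[OF B A _ k])
      moreover have "?x F = ?x (F - G) * ?x G"
        by (rule sqfree_monom_split[OF finite_subset[OF F(1) finite_atLeastAtMost] G(2)])
      ultimately show ?thesis by auto
    next
      case False
      then show ?thesis using non_face[OF F(1)] by (intro exI[of _ 1]) simp
    qed
    let ?gens = "?\<pi> ` ?x ` (Pow {1..n} - \<Sigma>)"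
    have gens_R: "?gens \<subseteq> carrier ?R" using hom.hom_closed xS by blast
    have "ideal {p \<in> carrier ?S. ?\<pi> p \<in> Idl\<^bsub>?R\<^esub> ?gens} ?S"
      by (rule hom.ideal_vimage[OF M.R.genideal_ideal[OF gens_R]])
    then have "SR_ideal n \<Sigma> \<subseteq> {p \<in> carrier ?S. ?\<pi> p \<in> Idl\<^bsub>?R\<^esub> ?gens}"
    proof (rule SR_ideal_minimal)
      fix F assume "F \<subseteq> {1..n}" "F \<notin> \<Sigma>"
      then show "?x F \<in> {p \<in> carrier ?S. ?\<pi> p \<in> Idl\<^bsub>?R\<^esub> ?gens}"
        using M.R.genideal_self[OF gens_R] xS by blast
    qed
    then have J_gens: "?J \<subseteq> Idl\<^bsub>?R\<^esub> ?gens" unfolding SR_ideal_image_def by blast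
    show "ideal_torsion ?R M ?J x"
    proof (rule ideal_torsionI_generators[OF M J _ gens_R J_gens x])
      fix g assume "g \<in> ?gens"
      then obtain F where F: "F \<subseteq> {1..n}" "F \<notin> \<Sigma>" "g = ?\<pi> (?x F)" by blast
      then show "\<exists>k::nat. (g [^]\<^bsub>?R\<^esub> k) \<odot>\<^bsub>M\<^esub> x = \<zero>\<^bsub>M\<^esub>"
        using rad A_iff[OF xS] by blast
    qed simp
  qed
qed

section \<open>The vanishing theorem\<close>

text \<open>The zero of the quotient is its only coset, which is what vanishing of cohomology amounts to.\<close>

lemma quotient_module_self:
  fixes M :: "('a, 'm) module"
  assumes "abelian_group M" "additive_subgroup K M"
  shows "carrier (quotient_module (M\<lparr>carrier := K\<rparr>) K) = {K}"
proof -
  interpret M: abelian_group M by fact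
  interpret K: additive_subgroup K M by fact
  have "K +>\<^bsub>M\<lparr>carrier := K\<rparr>\<^esub> a = K" if a: "a \<in> K" for a
  proof
    show "K +>\<^bsub>M\<lparr>carrier := K\<rparr>\<^esub> a \<subseteq> K"
      using a K.a_closed by (auto simp: a_r_coset_def')
    show "K \<subseteq> K +>\<^bsub>M\<lparr>carrier := K\<rparr>\<^esub> a"
    proof
      fix b assume b: "b \<in> K"
      have "b = (b \<oplus>\<^bsub>M\<^esub> \<ominus>\<^bsub>M\<^esub> a) \<oplus>\<^bsub>M\<^esub> a"
        using a b K.a_Hcarr by (simp add: M.a_assoc M.l_neg)
      moreover have "b \<oplus>\<^bsub>M\<^esub> \<ominus>\<^bsub>M\<^esub> a \<in> K"
        using a b K.a_closed K.a_inv_closed by simp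
      ultimately show "b \<in> K +>\<^bsub>M\<lparr>carrier := K\<rparr>\<^esub> a" by (auto simp: a_r_coset_def')
    qed
  qed
  moreover have "K \<noteq> {}" using K.zero_closed by blast
  ultimately have "(\<Union>a\<in>K. {K +>\<^bsub>M\<lparr>carrier := K\<rparr>\<^esub> a}) = {K}"
    by auto
  then show ?thesis
    by (simp add: quotient_module_def A_RCOSETS_def'[of "M\<lparr>carrier := K\<rparr>" K])
qed

lemma carrier_torsion_module:
  "carrier (torsion_module R J M) = {x \<in> carrier M. ideal_torsion R M J x}"
  by (simp add: torsion_module_def ideal_torsion_def)

lemma local_cohomology_trivialI:
  fixes I :: "int \<Rightarrow> ('a, 'm) module"
  assumes "abelian_group (I i)"
    and "additive_subgroup {x \<in> carrier (I i). ideal_torsion R (I i) J x \<and> \<delta> i x = \<zero>\<^bsub>I (i + 1)\<^esub>} (I i)"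
    and "\<delta> (i - 1) ` {x \<in> carrier (I (i - 1)). ideal_torsion R (I (i - 1)) J x} =
      {x \<in> carrier (I i). ideal_torsion R (I i) J x \<and> \<delta> i x = \<zero>\<^bsub>I (i + 1)\<^esub>}"
  shows "carrier (local_cohomology R J I \<delta> i) = {\<zero>\<^bsub>local_cohomology R J I \<delta> i\<^esub>}"
proof -
  let ?K = "{x \<in> carrier (I i). ideal_torsion R (I i) J x \<and> \<delta> i x = \<zero>\<^bsub>I (i + 1)\<^esub>}"
  have "a_kernel (torsion_module R J (I i)) (torsion_module R J (I (i + 1))) (\<delta> i) = ?K"
    by (simp add: a_kernel_def' carrier_torsion_module) (simp add: torsion_module_def conj_assoc)
  moreover have "(torsion_module R J (I i))\<lparr>carrier := ?K\<rparr> = (I i)\<lparr>carrier := ?K\<rparr>"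
    by (simp add: torsion_module_def)
  ultimately have eq: "local_cohomology R J I \<delta> i = quotient_module ((I i)\<lparr>carrier := ?K\<rparr>) ?K"
    by (simp add: local_cohomology_def cohomology_def carrier_torsion_module assms(3))
  show ?thesis
    unfolding eq quotient_module_self[OF assms(1,2)] by (simp add: quotient_module_def)
qed

theorem theorem3p3:
  fixes n d :: nat and \<Sigma> \<Delta> :: "nat set set"
    and R :: "'k::field mpoly set ring" and J :: "'k mpoly set set"
    and \<epsilon> :: "'k mpoly set \<Rightarrow> 'm" and I :: "int \<Rightarrow> ('k mpoly set, 'm) module"
    and \<delta> :: "int \<Rightarrow> 'm \<Rightarrow> 'm"
  defines "R \<equiv> SR_ring n \<Delta>" and "J \<equiv> SR_ideal_image n \<Delta> \<Sigma>"
  assumes "simplicial_complex n \<Sigma>" and "simplicial_complex n \<Delta>" and "\<Sigma> \<subseteq> \<Delta>"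
    and "krull_dim R = ereal (real d)"
    and "d \<noteq> 1" and "d \<noteq> 2"
    and "\<And>F. F \<in> faces \<Delta> (int d - 1) \<Longrightarrow> \<exists>v\<in>F. v \<in> vertices \<Sigma>"
    and "\<And>F G. F \<in> faces \<Delta> (int d - 1) \<Longrightarrow> G \<in> faces \<Delta> (int d - 2) \<Longrightarrow> G \<subseteq> F \<Longrightarrow>
           G \<in> faces \<Sigma> (int d - 2)"
    and "\<And>F. F \<in> facets \<Delta> (int d - 2) \<Longrightarrow> \<exists>v\<in>F. v \<in> vertices \<Sigma>"
    and "injective_resolution R (regular_module R) \<epsilon> I \<delta>"
  shows "carrier (local_cohomology R J I \<delta> (int d - 1)) =
         {\<zero>\<^bsub>local_cohomology R J I \<delta> (int d - 1)\<^esub>}"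
proof -
  note \<Sigma> = assms(3) and \<Delta> = assms(4) and res = assms(12)
  define i where "i = int d - 1"
  note mod = injective_resolutionD(2)[OF res]
  have ab: "abelian_group (I j)" for j using mod by (rule module.axioms(2))
  let ?K = "{x \<in> carrier (I i). ideal_torsion R (I i) J x \<and> \<delta> i x = \<zero>\<^bsub>I (i + 1)\<^esub>}"
  let ?T = "{x \<in> carrier (I (i - 1)). ideal_torsion R (I (i - 1)) J x}"
  have hom: "\<delta> (i - 1) \<in> mod_hom R (I (i - 1)) (I i)"
    using injective_resolutionD(3)[OF res, of "i - 1"] by simp
  have "additive_subgroup ?K (I i) \<and> \<delta> (i - 1) ` ?T = ?K"
  proof (cases "d = 0")
    case True
    \<comment> \<open>the degree is \<open>-1\<close>, where the resolution vanishes\<close>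
    then have "i < 0" by (simp add: i_def)
    have zero_tors: "ideal_torsion R (I j) J \<zero>\<^bsub>I j\<^esub>" for j
      unfolding ideal_torsion_def by (intro exI[of _ 0]) (simp add: module.smult_r_null[OF mod])
    have K: "?K = {\<zero>\<^bsub>I i\<^esub>}"
      using injective_resolutionD(4)[OF res \<open>i < 0\<close>] zero_tors
        mod_hom_zero[OF mod mod injective_resolutionD(3)[OF res, of i]] by auto
    have "?T = {\<zero>\<^bsub>I (i - 1)\<^esub>}"
      using injective_resolutionD(4)[OF res, of "i - 1"] \<open>i < 0\<close> zero_tors by auto
    moreover have "additive_subgroup {\<zero>\<^bsub>I i\<^esub>} (I i)"
      using group.triv_subgroup[OF abelian_group.a_group[OF ab, of i]]
      by (simp add: additive_subgroup_def)
    ultimately show ?thesis unfolding K by (simp add: mod_hom_zero[OF mod mod hom])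
  next
    case False
    then have d: "3 \<le> d" using assms(7,8) by linarith
    have dim: "card F \<le> d" if "F \<in> \<Delta>" for F
      using card_face_le_krull_dim[OF \<Delta> that, where ?'k = 'k] assms(6) by (simp add: R_def)
    have "\<exists>\<G> \<rho>. ranked_cover \<Delta> \<Sigma> (d - 2) \<G> \<rho>"
      by (rule exists_ranked_cover[OF \<Sigma> \<Delta> d]) (erule dim, erule (2) assms(10), erule assms(11))
    then obtain \<G> \<rho> where cover: "ranked_cover \<Delta> \<Sigma> (d - 2) \<G> \<rho>" by blast
    define fs where "fs = (rank_sums n \<Delta> \<G> \<rho> (d - 2) :: 'k mpoly set list)"
    \<comment> \<open>there are \<open>d - 2\<close> sums, fewer than the cohomological degree \<open>d - 1\<close>\<close>
    have len: "int (length fs) < i" using d by (simp add: fs_def rank_sums_def i_def)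
    note transfer = torsion_iff_rank_sums_torsion[OF \<Delta> cover]
    have tors: "ideal_torsion R (I j) J x \<longleftrightarrow> power_torsion R (I j) fs x" if "x \<in> carrier (I j)" for j x
      using transfer(2)[of "I j" x] mod[of j] that unfolding R_def J_def fs_def by simp
    have fs: "set fs \<subseteq> carrier R"
      using transfer(1)[of "I 0" "\<zero>\<^bsub>I 0\<^esub>"] mod[of 0]
        abelian_monoid.zero_closed[OF abelian_group.axioms(1)[OF ab[of 0]]]
      unfolding R_def fs_def by simp
    have acc: "acc_on (\<lambda>K. ideal K R)" unfolding R_def by (rule acc_SR_ring)
    interpret Ii: module R "I i" by (rule mod)
    note hom_i = injective_resolutionD(3)[OF res, of i]
    have K: "?K = {x \<in> carrier (I i). power_torsion R (I i) fs x \<and> \<delta> i x = \<zero>\<^bsub>I (i + 1)\<^esub>}"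
      using tors by auto
    have "subgroup ?K (add_monoid (I i))"
    proof (rule Ii.M.add.subgroupI)
      show "?K \<subseteq> carrier (I i)" by auto
      have "power_torsion R (I i) fs \<zero>\<^bsub>I i\<^esub>"
        using fs unfolding power_torsion_def by (auto intro!: exI[of _ 0])
      then show "?K \<noteq> {}" unfolding K using mod_hom_zero[OF mod mod hom_i] by blast
    next
      fix x assume x: "x \<in> ?K"
      have m1: "\<ominus>\<^bsub>R\<^esub> \<one>\<^bsub>R\<^esub> \<in> carrier R" by simp
      have eq: "\<ominus>\<^bsub>I i\<^esub> x = (\<ominus>\<^bsub>R\<^esub> \<one>\<^bsub>R\<^esub>) \<odot>\<^bsub>I i\<^esub> x"
        using x by (simp add: Ii.smult_l_minus)
      show "\<ominus>\<^bsub>I i\<^esub> x \<in> ?K"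
        using x power_torsion_smult[OF mod fs _ m1, of x i] mod_homD(3)[OF hom_i m1]
          module.smult_r_null[OF mod m1] unfolding K eq by simp
    next
      fix x y assume "x \<in> ?K" "y \<in> ?K"
      then show "x \<oplus>\<^bsub>I i\<^esub> y \<in> ?K"
        using power_torsion_add[OF mod fs, of x i y] mod_homD(2)[OF hom_i]
          unfolding K
        by (simp add: abelian_monoid.r_zero[OF abelian_group.axioms(1)[OF ab]]
            abelian_monoid.zero_closed[OF abelian_group.axioms(1)[OF ab]])
    qed
    moreover have "\<delta> (i - 1) ` ?T \<subseteq> ?K"
    proof
      fix y assume "y \<in> \<delta> (i - 1) ` ?T"
      then obtain x where x: "x \<in> carrier (I (i - 1))" "power_torsion R (I (i - 1)) fs x" "y = \<delta> (i - 1) x"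
        using tors by blast
      have "y \<in> \<delta> (i - 1) ` carrier (I (i - 1))" using x by blast
      then have "y \<in> carrier (I i)" "\<delta> i y = \<zero>\<^bsub>I (i + 1)\<^esub>"
        using injective_resolutionD(5)[OF res, of i] len by auto
      moreover have "power_torsion R (I i) fs y"
        unfolding x(3) by (rule power_torsion_mod_hom[OF mod mod hom fs x(1,2)])
      ultimately show "y \<in> ?K" unfolding K by blast
    qed
    moreover have "?K \<subseteq> \<delta> (i - 1) ` ?T"
    proof
      fix x assume "x \<in> ?K"
      then have "x \<in> carrier (I i)" "\<delta> i x = \<zero>\<^bsub>I (i + 1)\<^esub>" "power_torsion R (I i) fs x"
        unfolding K by auto
      from power_torsion_cocycle_is_coboundary[OF res acc fs len this]
      show "x \<in> \<delta> (i - 1) ` ?T" using tors by blast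
    qed
    ultimately show ?thesis by (simp add: additive_subgroup_def subset_antisym)
  qed
  then show ?thesis
    using local_cohomology_trivialI[where I = I and R = R and J = J and \<delta> = \<delta> and i = i, OF ab] unfolding i_def by simp
qed

end
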